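(* Let $U$ be a unicyclic graph of order $n \ge 4$, let $v$ be a pendant vertex of the path $P_{n-2}$, and let $W=C_{3}(v)\circ P_{n-2}(v)$. Let $m=\min\{\rho(W^{2}),\rho(C_{n}^{2})\}$. Then $\rho(U^{2})\geq m$, with equality if and only if $U$ is (isomorphic to) one of $W$, $C_n$ and the square of that graph has spectral radius $m$.
   Context: All graphs are simple, undirected and finite. A unicyclic graph is a connected graph containing exactly one cycle. $C_k$ is the cycle and $P_k$ the path on $k$ vertices. $\rho(G)$ is the spectral radius of the adjacency matrix of $G$. The square $G^2$ of a connected graph $G$ is obtained from $G$ by adding an edge between every pair of vertices at distance $2$ in $G$. For vertex-disjoint connected graphs $G_1,G_2$, $G_1(v)\circ G_2(v)$ denotes the coalescence obtained by identifying a vertex of $G_1$ with a vertex of $G_2$ into a single vertex $v$; thus $W$ is a triangle with a path of $n-3$ further vertices attached at one of its vertices. *)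

theory Defs
  imports "Graph_Theory.Graph_Theory" "Jordan_Normal_Form.Spectral_Radius"
begin

text \<open>
  A finite simple undirected graph is a record \<^typ>\<open>'a pair_pre_digraph\<close> satisfying the predicate
  \<^const>\<open>pair_graph\<close>: its arcs form a finite, symmetric, loop-free relation on a finite vertex set,
  an edge being represented by its two opposite arcs.
\<close>

text \<open>Meaningful for \<open>n \<ge> 3\<close> only: \<open>cycle_graph 1\<close> has a loop and \<open>cycle_graph 2\<close> is a single edge.\<close>

definition cycle_graph :: "nat \<Rightarrow> nat pair_pre_digraph" where
  "cycle_graph n =
    \<lparr> pverts = {..<n},
      parcs = {(i, j). i < n \<and> j < n \<and> (j = Suc i mod n \<or> i = Suc j mod n)} \<rparr>"

definition path_graph :: "nat \<Rightarrow> nat pair_pre_digraph" where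
  "path_graph n =
    \<lparr> pverts = {..<n}, parcs = {(i, j). i < n \<and> j < n \<and> (j = Suc i \<or> i = Suc j)} \<rparr>"

definition pendant_vertex :: "'a pair_pre_digraph \<Rightarrow> 'a \<Rightarrow> bool" where
  "pendant_vertex G v \<longleftrightarrow> v \<in> pverts G \<and> out_degree (with_proj G) v = 1"

text \<open>
  Cycles are counted as subgraphs, not as closed walks, so neither the starting vertex nor the
  direction matters. The qualified name avoids the topological notion of connectedness.
\<close>

definition unicyclic :: "'a pair_pre_digraph \<Rightarrow> bool" where
  "unicyclic G \<longleftrightarrow> pair_graph G \<and> Digraph_Component.connected (with_proj G) \<and>
    (\<exists>!H :: 'a pair_pre_digraph. subgraph (with_proj H) (with_proj G) \<and>
      (\<exists>k\<ge>3. digraph_iso (with_proj H) (with_proj (cycle_graph k))))"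

definition graph_dist :: "'a pair_pre_digraph \<Rightarrow> 'a \<Rightarrow> 'a \<Rightarrow> ereal" where
  "graph_dist G u v = wf_digraph.\<mu> (with_proj G) (\<lambda>_. 1) u v"

definition graph_square :: "'a pair_pre_digraph \<Rightarrow> 'a pair_pre_digraph" where
  "graph_square G =
    \<lparr> pverts = pverts G,
      parcs = parcs G \<union> {(u, v). u \<in> pverts G \<and> v \<in> pverts G \<and> graph_dist G u v = 2} \<rparr>"

text \<open>The disjoint union of two graphs in which the vertex \<open>b\<close> of the second one is identified with
  the vertex \<open>a\<close> of the first one; the common vertex is \<^term>\<open>Inl a\<close>.\<close>

definition coalescence ::
    "'a pair_pre_digraph \<Rightarrow> 'a \<Rightarrow> 'b pair_pre_digraph \<Rightarrow> 'b \<Rightarrow> ('a + 'b) pair_pre_digraph" where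
  "coalescence G a H b =
    (let f = (\<lambda>y. if y = b then Inl a else Inr y)
     in \<lparr> pverts = Inl ` pverts G \<union> f ` pverts H,
          parcs = map_prod Inl Inl ` parcs G \<union> map_prod f f ` parcs H \<rparr>)"

definition adjacency_matrix :: "'a pair_pre_digraph \<Rightarrow> 'a list \<Rightarrow> complex mat" where
  "adjacency_matrix G vs =
    mat (length vs) (length vs) (\<lambda>(i, j). if (vs ! i, vs ! j) \<in> parcs G then 1 else 0)"

text \<open>
  Adjacency matrices for different enumerations of the vertices are permutation similar, so the
  value does not depend on the enumeration that is chosen.
\<close>

definition graph_spectral_radius :: "'a pair_pre_digraph \<Rightarrow> real" where
  "graph_spectral_radius G =
    spectral_radius (adjacency_matrix G (SOME vs. distinct vs \<and> set vs = pverts G))"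

end

(*
The spectral radius of a symmetric 0-1 matrix is the maximum of its quadratic form on the unit sphere, so
every test vector gives a lower bound.

Vertices are listed along a path 0, 1, 2, ... whose first vertex is also joined to vertex k - 1; W is such
a spanning "lasso" with k = 3. The square of W then has the edges {i, j} with |i - j| <= 2 and {0, 3},
and for n >= 5 the positive vector (3, 3, 4, 5, 5, ...) shows that its radius is below 4.

A cycle of length at least 5 forces radius at least 4 by the all-ones vector on it. Otherwise take a
longest lasso in U. If k = 4 and it spans U, the square of U contains that of W properly; if it does not
span U, counting edges gives radius at least 4. If k = 3 and two vertices hang off the lasso, the all-ones
vector again gives 4; if a path of two vertices hangs off it, so does the vector with value 1/2 at the
last vertices of the two branches and 1 elsewhere. In the remaining case a single vertex u hangs off the
lasso, and inserting u into the list next to its neighbour turns the Perron vector of the square of W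
into a test vector on U with a strictly larger quadratic form.
*)
theory Submission
  imports Defs "HOL-Analysis.Function_Topology"
begin

section \<open>Spectral radius and quadratic form\<close>

text \<open>The threshold 4 is the row sum of the square of a two-way infinite path. The square of
  \<open>W\<close> stays below it for every order n >= 5, so a competitor whose square carries about
  two edges per vertex is settled by counting. The exact radius of the square of \<open>W\<close> is
  never computed; graphs that the count does not catch are compared with it through its Perron
  vector, and there the strict inequality comes from gained edges, whose weights are positive. One
  cycle suffices for all lower bounds. That it is the only one enters just once, to show that a
  spanning lasso has no further edges, so that k = 3 really gives \<open>W\<close>; connectedness
  serves to find a vertex attached to a lasso that does not span. Order 4 is separate: there the
  squares of \<open>W\<close> and of the 4-cycle are both complete and both attain the minimum. From
  order 5 on, the square of the cycle has radius at least 4 and is never the minimum.\<close>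

definition quad :: "'a set \<Rightarrow> ('a \<times> 'a) set \<Rightarrow> ('a \<Rightarrow> real) \<Rightarrow> real" where
  "quad V E f = (\<Sum>u\<in>V. \<Sum>v\<in>V. if (u, v) \<in> E then f u * f v else 0)"

definition nbr_sum :: "'a set \<Rightarrow> ('a \<times> 'a) set \<Rightarrow> ('a \<Rightarrow> real) \<Rightarrow> 'a \<Rightarrow> real" where
  "nbr_sum V E f u = (\<Sum>v\<in>V. if (u, v) \<in> E then f v else 0)"

lemma quad_nbr_sum: "quad V E f = (\<Sum>u\<in>V. f u * nbr_sum V E f u)"
  unfolding quad_def nbr_sum_def sum_distrib_left
  by (intro sum.cong refl) auto

lemma quad_abs_le: "quad V E f \<le> quad V E (\<lambda>v. \<bar>f v\<bar>)"
  unfolding quad_def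
  by (intro sum_mono) (auto simp flip: abs_mult)

lemma quad_scale: "quad V E (\<lambda>v. c * f v) = c\<^sup>2 * quad V E f"
  unfolding quad_def sum_distrib_left
  by (intro sum.cong refl) (auto simp: power2_eq_square)

text \<open>Row \<open>w\<close> and column \<open>w\<close> each contribute \<open>t\<close> times
  the neighbour sum; symmetry of \<open>E\<close> makes the two contributions equal.\<close>

lemma quad_perturb:
  assumes "finite V" "sym E" "w \<in> V"
  shows "quad V E (\<lambda>v. f v + (if v = w then t else 0)) =
    quad V E f + 2 * t * nbr_sum V E f w + t\<^sup>2 * (if (w, w) \<in> E then 1 else 0)"
proof -
  have E: "(v, w) \<in> E \<longleftrightarrow> (w, v) \<in> E" for v
    using assms(2) by (auto dest: symD)
  have "quad V E (\<lambda>v. f v + (if v = w then t else 0)) =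
    (\<Sum>u\<in>V. \<Sum>v\<in>V. (if (u, v) \<in> E then f u * f v else 0)
      + (if v = w then (if (u, v) \<in> E then f u * t else 0) else 0)
      + (if u = w then (if (u, v) \<in> E then t * f v else 0) else 0)
      + (if u = w then (if v = w then (if (w, w) \<in> E then t * t else 0) else 0) else 0))"
    unfolding quad_def by (intro sum.cong refl) (auto simp: algebra_simps)
  also have "\<dots> = quad V E f + (\<Sum>u\<in>V. if (u, w) \<in> E then f u * t else 0)
      + (\<Sum>u\<in>V. \<Sum>v\<in>V. if u = w then (if (u, v) \<in> E then t * f v else 0) else 0)
      + (\<Sum>u\<in>V. \<Sum>v\<in>V. if u = w then (if v = w then (if (w, w) \<in> E then t * t else 0) else 0) else 0)"
    using assms by (simp add: sum.distrib quad_def sum.delta)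
  also have "(\<Sum>u\<in>V. if (u, w) \<in> E then f u * t else 0) = t * nbr_sum V E f w"
    unfolding nbr_sum_def sum_distrib_left by (intro sum.cong refl) (auto simp: E)
  also have "(\<Sum>u\<in>V. \<Sum>v\<in>V. if u = w then (if (u, v) \<in> E then t * f v else 0) else 0)
      = t * nbr_sum V E f w"
    unfolding nbr_sum_def sum_distrib_left
    using assms by (subst sum.swap) (auto simp: sum.delta intro!: sum.cong)
  also have "(\<Sum>u\<in>V. \<Sum>v\<in>V. if u = w then (if v = w then (if (w, w) \<in> E then t * t else 0) else 0) else 0)
      = t\<^sup>2 * (if (w, w) \<in> E then 1 else 0)"
    using assms by (subst sum.swap) (auto simp: sum.delta power2_eq_square)
  finally show ?thesis by simp
qed

lemma sum_squares_perturb: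
  fixes f :: "'a \<Rightarrow> real"
  assumes "finite V" "w \<in> V"
  shows "(\<Sum>v\<in>V. (f v + (if v = w then t else 0))\<^sup>2) = (\<Sum>v\<in>V. (f v)\<^sup>2) + 2 * t * f w + t\<^sup>2"
proof -
  have "(\<Sum>v\<in>V. (f v + (if v = w then t else 0))\<^sup>2) =
      (\<Sum>v\<in>V. (f v)\<^sup>2 + (if v = w then 2 * t * f v + t\<^sup>2 else 0))"
    by (intro sum.cong refl) (auto simp: power2_eq_square algebra_simps)
  then show ?thesis using assms by (simp add: sum.distrib sum.delta)
qed

section \<open>Maximisers of the quadratic form on the unit sphere\<close>

lemma quadratic_dominates_linear_imp_zero:
  fixes d c :: real
  assumes "\<And>t. 2 * t * d \<le> t\<^sup>2 * c"
  shows "d = 0"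
proof (rule ccontr)
  assume "d \<noteq> 0"
  \<comment> \<open>With b > 0 and b > c, the choice t = d / b in the assumption gives 2 b <= c
    after cancelling the square of d.\<close>
  define b where "b = \<bar>c\<bar> + 1"
  have b: "b > 0" "c < b" by (auto simp: b_def)
  have "2 * (d / b) * d * b\<^sup>2 \<le> (d / b)\<^sup>2 * c * b\<^sup>2"
    using assms[of "d / b"] by (intro mult_right_mono) auto
  then have "2 * b * d\<^sup>2 \<le> c * d\<^sup>2"
    using b by (simp add: power2_eq_square field_simps)
  then have "2 * b \<le> c" using \<open>d \<noteq> 0\<close> by simp
  then show False using b by simp
qed

text \<open>At a maximiser the first variation in every single coordinate vanishes. Testing one
  coordinate at a time gives the eigenvalue equation row by row, without derivatives or
  multipliers.\<close>

lemma quad_maximiser_eigenvector: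
  assumes "finite V" "sym E" "w \<in> V"
    and le: "\<And>g. quad V E g \<le> \<mu> * (\<Sum>v\<in>V. (g v)\<^sup>2)"
    and eq: "quad V E f = \<mu> * (\<Sum>v\<in>V. (f v)\<^sup>2)"
  shows "nbr_sum V E f w = \<mu> * f w"
proof -
  have "2 * t * (nbr_sum V E f w - \<mu> * f w) \<le> t\<^sup>2 * (\<mu> - (if (w, w) \<in> E then 1 else 0))" for t
    using le[of "\<lambda>v. f v + (if v = w then t else 0)"] eq
    unfolding quad_perturb[OF assms(1-3)] sum_squares_perturb[OF assms(1,3)]
    by (simp add: algebra_simps)
  from quadratic_dominates_linear_imp_zero[OF this] show ?thesis by simp
qed

text \<open>Functions live on the whole, possibly infinite type. Pinned to 0 outside
  \<open>V\<close> they lie in a product of compact sets, intervals over \<open>V\<close> and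
  singletons elsewhere, so Tychonoff's theorem applies.\<close>

lemma compact_unit_sphere_fun:
  fixes V :: "'a set"
  assumes "finite V"
  shows "compact {f :: 'a \<Rightarrow> real. (\<forall>v. v \<notin> V \<longrightarrow> f v = 0) \<and> (\<Sum>v\<in>V. (f v)\<^sup>2) = 1}" (is "compact ?S")
proof -
  define K :: "('a \<Rightarrow> real) set" where "K = PiE UNIV (\<lambda>v. if v \<in> V then {-1..1} else {0})"
  have "compactin (product_topology (\<lambda>_. euclidean) UNIV) K"
    unfolding K_def compactin_PiE by auto
  then have K: "compact K"
    by (simp add: euclidean_product_topology)
  have "closed {f :: 'a \<Rightarrow> real. (\<Sum>v\<in>V. (f v)\<^sup>2) = 1}"
    by (intro closed_Collect_eq continuous_intros) auto
  then have "compact (K \<inter> {f. (\<Sum>v\<in>V. (f v)\<^sup>2) = 1})"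
    using K by (rule compact_Int_closed[rotated])
  moreover have "?S = K \<inter> {f. (\<Sum>v\<in>V. (f v)\<^sup>2) = 1}"
  proof -
    have "\<bar>f v\<bar> \<le> 1" if "(\<Sum>v\<in>V. (f v)\<^sup>2) = 1" "v \<in> V" for f :: "'a \<Rightarrow> real" and v
    proof -
      have "(f v)\<^sup>2 \<le> (\<Sum>v\<in>V. (f v)\<^sup>2)"
        using assms that by (intro member_le_sum) auto
      then show ?thesis using that by (simp add: abs_square_le_1)
    qed
    then have "f \<in> K \<longleftrightarrow> (\<forall>v. v \<notin> V \<longrightarrow> f v = 0)" if "(\<Sum>v\<in>V. (f v)\<^sup>2) = 1" for f
      using that unfolding K_def PiE_iff by (auto simp: abs_le_iff minus_le_iff)
    then show ?thesis by auto
  qed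
  ultimately show ?thesis by simp
qed

lemma nonneg_maximal_eigenvector:
  assumes fin: "finite V" and ne: "V \<noteq> {}" and sym: "sym E"
  obtains \<mu> f where "\<And>v. 0 \<le> f v" "(\<Sum>v\<in>V. (f v)\<^sup>2) = 1"
    "\<And>u. u \<in> V \<Longrightarrow> nbr_sum V E f u = \<mu> * f u"
    "\<And>g. quad V E g \<le> \<mu> * (\<Sum>v\<in>V. (g v)\<^sup>2)"
proof -
  define S where "S = {f :: 'a \<Rightarrow> real. (\<forall>v. v \<notin> V \<longrightarrow> f v = 0) \<and> (\<Sum>v\<in>V. (f v)\<^sup>2) = 1}"
  obtain w where "w \<in> V" using ne by auto
  then have "(\<lambda>v. if v = w then 1 else 0) \<in> S"
    using fin by (auto simp: S_def if_distrib[of "\<lambda>x. x\<^sup>2"] sum.delta cong: if_cong)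
  then have "S \<noteq> {}" by auto
  moreover have "continuous_on S (quad V E)"
  proof -
    have "continuous_on S (\<lambda>f. if (u, v) \<in> E then f u * f v else 0)" for u v
      by (cases "(u, v) \<in> E")
        (auto intro!: continuous_intros continuous_on_subset[OF continuous_on_product_coordinates])
    then show ?thesis unfolding quad_def[abs_def] by (intro continuous_intros)
  qed
  ultimately obtain f where f: "f \<in> S" "\<And>g. g \<in> S \<Longrightarrow> quad V E g \<le> quad V E f"
    using continuous_attains_sup[OF compact_unit_sphere_fun[OF fin, folded S_def]] by blast
  define \<mu> where "\<mu> = quad V E f"
  have le: "quad V E g \<le> \<mu> * (\<Sum>v\<in>V. (g v)\<^sup>2)" for g
  proof (cases "(\<Sum>v\<in>V. (g v)\<^sup>2) = 0")
    case True
    then have "\<forall>v\<in>V. g v = 0" using fin by (simp add: sum_nonneg_eq_0_iff)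
    then have "quad V E g = 0" unfolding quad_def by (auto intro!: sum.neutral)
    then show ?thesis using True by simp
  next
    case False
    define N where "N = (\<Sum>v\<in>V. (g v)\<^sup>2)"
    have N: "N > 0" using False sum_nonneg[of V "\<lambda>v. (g v)\<^sup>2"] unfolding N_def by auto
    define h where "h = (\<lambda>v. if v \<in> V then 1 / sqrt N * g v else 0)"
    have "(\<Sum>v\<in>V. (h v)\<^sup>2) = (\<Sum>v\<in>V. 1 / N * (g v)\<^sup>2)"
      using N by (intro sum.cong refl) (auto simp: h_def power_mult_distrib power_divide)
    also have "\<dots> = 1" using N by (simp only: sum_distrib_left[symmetric] N_def[symmetric]) simp
    finally have "h \<in> S" by (auto simp: S_def h_def)
    then have "quad V E h \<le> \<mu>" using f unfolding \<mu>_def by blast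
    moreover have "quad V E h = quad V E (\<lambda>v. 1 / sqrt N * g v)"
      unfolding quad_def h_def by (intro sum.cong refl) auto
    ultimately have "quad V E g / N \<le> \<mu>"
      using N by (simp only: quad_scale) (simp add: power_divide)
    then show ?thesis using N unfolding N_def by (simp add: field_simps)
  qed
  \<comment> \<open>Absolute values keep the norm and cannot lower the form, so the maximiser may be
    taken nonnegative.\<close>
  define h where "h = (\<lambda>v. \<bar>f v\<bar>)"
  have hs: "(\<Sum>v\<in>V. (h v)\<^sup>2) = 1" using f by (simp add: h_def S_def)
  have "quad V E h = \<mu> * (\<Sum>v\<in>V. (h v)\<^sup>2)"
    using le[of h] quad_abs_le[of V E f] f(1) by (simp add: h_def \<mu>_def S_def)
  note eig = quad_maximiser_eigenvector[OF fin sym _ le this]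
  show ?thesis
  proof (rule that[of h \<mu>])
    show "0 \<le> h v" for v by (simp add: h_def)
    show "nbr_sum V E h u = \<mu> * h u" if "u \<in> V" for u using that by (rule eig)
    show "quad V E g \<le> \<mu> * (\<Sum>v\<in>V. (g v)\<^sup>2)" for g by (rule le)
  qed (rule hs)
qed

text \<open>The vector \<open>f\<close> makes \<open>\<mu>\<close> an eigenvalue. Conversely, for a
  complex eigenvector with eigenvalue l the vector \<open>h\<close> of moduli satisfies |l| h <= A h
  entrywise by the triangle inequality, and pairing with \<open>h\<close> bounds |l| by
  \<open>\<mu>\<close>. No spectral theorem for symmetric matrices is involved.\<close>

lemma spectral_radius_adjacency_matrix:
  assumes vs: "distinct vs" "set vs = V" and fin: "finite V" "V \<noteq> {}"
    and f: "(\<Sum>v\<in>V. (f v)\<^sup>2) = 1"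
      "\<And>u. u \<in> V \<Longrightarrow> nbr_sum V (parcs G) f u = \<mu> * f u"
    and le: "\<And>g. quad V (parcs G) g \<le> \<mu> * (\<Sum>v\<in>V. (g v)\<^sup>2)"
  shows "spectral_radius (adjacency_matrix G vs) = \<mu>"
proof -
  define n where "n = length vs"
  define A where "A = adjacency_matrix G vs"
  have A: "A \<in> carrier_mat n n" by (simp add: A_def adjacency_matrix_def n_def)
  have n: "n > 0" using vs fin by (auto simp: n_def)
  have bij: "bij_betw (\<lambda>i. vs ! i) {0..<n} V"
    using bij_betw_nth[OF vs(1), of "{0..<n}" V] vs(2)
    by (simp add: n_def atLeast0LessThan)
  have mult: "(A *\<^sub>v x) $ i = (\<Sum>j\<in>{0..<n}. if (vs ! i, vs ! j) \<in> parcs G then x $ j else 0)"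
    if "i < n" "x \<in> carrier_vec n" for i x
    using that by (auto simp: A_def adjacency_matrix_def n_def scalar_prod_def intro!: sum.cong)
  have V: "vs ! i \<in> V" if "i < n" for i using that vs by (auto simp: n_def)
  have "eigenvalue A (of_real \<mu>)"
  proof -
    define x where "x = vec n (\<lambda>i. complex_of_real (f (vs ! i)))"
    have "A *\<^sub>v x = of_real \<mu> \<cdot>\<^sub>v x"
    proof (intro eq_vecI)
      fix i assume "i < dim_vec (of_real \<mu> \<cdot>\<^sub>v x)"
      then have i: "i < n" by (simp add: x_def)
      have "(A *\<^sub>v x) $ i = (\<Sum>j\<in>{0..<n}. if (vs ! i, vs ! j) \<in> parcs G then x $ j else 0)"
        using i by (intro mult) (auto simp: x_def)
      also have "\<dots> = (\<Sum>j\<in>{0..<n}. (\<lambda>v. if (vs ! i, v) \<in> parcs G then complex_of_real (f v) else 0) (vs ! j))"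
        by (intro sum.cong) (auto simp: x_def)
      also have "\<dots> = (\<Sum>v\<in>V. if (vs ! i, v) \<in> parcs G then complex_of_real (f v) else 0)"
        by (rule sum.reindex_bij_betw[OF bij])
      also have "\<dots> = of_real (nbr_sum V (parcs G) f (vs ! i))"
        unfolding nbr_sum_def of_real_sum by (intro sum.cong) auto
      also have "\<dots> = (of_real \<mu> \<cdot>\<^sub>v x) $ i"
        using i f(2)[OF V[OF i]] by (simp add: x_def)
      finally show "(A *\<^sub>v x) $ i = (of_real \<mu> \<cdot>\<^sub>v x) $ i" .
    qed (use A in \<open>auto simp: x_def\<close>)
    moreover have "x \<noteq> 0\<^sub>v n"
    proof
      assume x0: "x = 0\<^sub>v n"
      have "f (vs ! i) = 0" if "i < n" for i
        using arg_cong[OF x0, of "\<lambda>y. y $ i"] that by (simp add: x_def)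
      then have "\<forall>v\<in>V. f v = 0" using vs by (auto simp: n_def in_set_conv_nth)
      then show False using f(1) by simp
    qed
    ultimately show ?thesis using A
      unfolding eigenvalue_def eigenvector_def by (auto intro!: exI[of _ x] simp: x_def)
  qed
  then have 1: "cmod (of_real \<mu>) \<le> spectral_radius A"
    unfolding spectrum_def by (intro spectral_radius_mem_max(2)[OF A n] imageI) (simp add: spectrum_def)
  obtain l where l: "eigenvalue A l" "spectral_radius A = cmod l"
    using spectral_radius_mem_max(1)[OF A n] by (auto simp: spectrum_def)
  then obtain x where x: "x \<in> carrier_vec n" "x \<noteq> 0\<^sub>v n" "A *\<^sub>v x = l \<cdot>\<^sub>v x"
    using A unfolding eigenvalue_def eigenvector_def by auto
  define h where "h = (\<lambda>v. cmod (x $ (the_inv_into {0..<n} (\<lambda>i. vs ! i) v)))"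
  have h: "h (vs ! i) = cmod (x $ i)" if "i < n" for i
    using that bij by (simp add: h_def the_inv_into_f_f bij_betw_def)
  have "cmod l * h (vs ! i) \<le> nbr_sum V (parcs G) h (vs ! i)" if "i < n" for i
  proof -
    have "cmod l * h (vs ! i) = cmod ((l \<cdot>\<^sub>v x) $ i)"
      using that x by (simp add: h norm_mult)
    also have "\<dots> = cmod (\<Sum>j\<in>{0..<n}. if (vs ! i, vs ! j) \<in> parcs G then x $ j else 0)"
      unfolding x(3)[symmetric] mult[OF that x(1)] ..
    also have "\<dots> \<le> (\<Sum>j\<in>{0..<n}. cmod (if (vs ! i, vs ! j) \<in> parcs G then x $ j else 0))"
      by (rule norm_sum)
    also have "\<dots> = (\<Sum>j\<in>{0..<n}. (\<lambda>v. if (vs ! i, v) \<in> parcs G then h v else 0) (vs ! j))"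
      by (intro sum.cong) (auto simp: h)
    also have "\<dots> = nbr_sum V (parcs G) h (vs ! i)"
      unfolding nbr_sum_def by (rule sum.reindex_bij_betw[OF bij])
    finally show ?thesis .
  qed
  then have sub: "cmod l * h v \<le> nbr_sum V (parcs G) h v" if "v \<in> V" for v
    using that vs by (auto simp: n_def in_set_conv_nth)
  have "cmod l * (\<Sum>v\<in>V. (h v)\<^sup>2) = (\<Sum>v\<in>V. h v * (cmod l * h v))"
    by (simp add: sum_distrib_left power2_eq_square mult_ac)
  also have "\<dots> \<le> quad V (parcs G) h"
    unfolding quad_nbr_sum using sub by (intro sum_mono mult_left_mono) (auto simp: h_def)
  also have "\<dots> \<le> \<mu> * (\<Sum>v\<in>V. (h v)\<^sup>2)" by (rule le)
  finally have "cmod l * (\<Sum>v\<in>V. (h v)\<^sup>2) \<le> \<mu> * (\<Sum>v\<in>V. (h v)\<^sup>2)" .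
  moreover have "(\<Sum>v\<in>V. (h v)\<^sup>2) > 0"
  proof -
    obtain i where i: "i < n" "x $ i \<noteq> 0" using x by (auto simp: vec_eq_iff)
    then have "(h (vs ! i))\<^sup>2 > 0" by (simp add: h)
    then show ?thesis using V[OF i(1)] fin by (intro sum_pos2[of _ "vs ! i"]) auto
  qed
  ultimately have "cmod l \<le> \<mu>" by simp
  with 1 l(2) show ?thesis unfolding A_def by simp
qed

text \<open>The enumeration chosen by \<open>SOME\<close> disappears here, because
  \<open>\<mu>\<close> is obtained without any enumeration. All later arguments use the spectral
  radius only through this description.\<close>

proposition graph_spectral_radius_eigenvector:
  assumes "finite (pverts G)" "pverts G \<noteq> {}" "sym (parcs G)"
  obtains f where "\<And>v. 0 \<le> f v" "(\<Sum>v\<in>pverts G. (f v)\<^sup>2) = 1"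
    "\<And>u. u \<in> pverts G \<Longrightarrow> nbr_sum (pverts G) (parcs G) f u = graph_spectral_radius G * f u"
    "\<And>g. quad (pverts G) (parcs G) g \<le> graph_spectral_radius G * (\<Sum>v\<in>pverts G. (g v)\<^sup>2)"
proof (rule nonneg_maximal_eigenvector[OF assms])
  fix f \<mu> assume f: "\<And>v. 0 \<le> f v" "(\<Sum>v\<in>pverts G. (f v)\<^sup>2) = 1"
    "\<And>u. u \<in> pverts G \<Longrightarrow> nbr_sum (pverts G) (parcs G) f u = \<mu> * f u"
    "\<And>g. quad (pverts G) (parcs G) g \<le> \<mu> * (\<Sum>v\<in>pverts G. (g v)\<^sup>2)"
  define vs where "vs = (SOME vs. distinct vs \<and> set vs = pverts G)"
  have "distinct vs \<and> set vs = pverts G"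
    unfolding vs_def by (rule someI_ex) (use finite_distinct_list[OF assms(1)] in auto)
  then have "spectral_radius (adjacency_matrix G vs) = \<mu>"
    using spectral_radius_adjacency_matrix[OF _ _ assms(1,2) f(2-4)] by blast
  then have \<mu>: "\<mu> = graph_spectral_radius G"
    by (simp add: graph_spectral_radius_def vs_def)
  show ?thesis
  proof (rule that[of f])
    show "nbr_sum (pverts G) (parcs G) f u = graph_spectral_radius G * f u" if "u \<in> pverts G" for u
      using f(3)[OF that] \<mu> by simp
    show "quad (pverts G) (parcs G) g \<le> graph_spectral_radius G * (\<Sum>v\<in>pverts G. (g v)\<^sup>2)" for g
      using f(4) \<mu> by simp
  qed (rule f)+
qed

section \<open>Squares of graphs\<close>

definition within2 :: "'a rel \<Rightarrow> 'a rel" where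
  "within2 E = {(u, v). u \<noteq> v \<and> ((u, v) \<in> E \<or> (\<exists>w. (u, w) \<in> E \<and> (w, v) \<in> E))}"

lemma within2_arc: "(u, v) \<in> E \<Longrightarrow> u \<noteq> v \<Longrightarrow> (u, v) \<in> within2 E"
  and within2_common: "(u, w) \<in> E \<Longrightarrow> (w, v) \<in> E \<Longrightarrow> u \<noteq> v \<Longrightarrow> (u, v) \<in> within2 E"
  by (auto simp: within2_def)

lemma sym_within2: "sym E \<Longrightarrow> sym (within2 E)"
  unfolding within2_def sym_def by blast

context pair_graph begin

lemma sym_parcs: "sym (parcs G)"
  by (auto intro!: symI arcs_symmetric)

text \<open>The distance is an infimum of lengths over all walks, so only walks with at most two
  arcs have to be inspected.\<close>

lemma graph_dist_eq_2_iff: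
  "graph_dist G u v = 2 \<longleftrightarrow>
    u \<noteq> v \<and> (u, v) \<notin> parcs G \<and> (\<exists>w. (u, w) \<in> parcs G \<and> (w, v) \<in> parcs G)"
  if uv: "u \<in> pverts G" "v \<in> pverts G"
proof -
  let ?d = "graph_dist G u v"
  have cost: "awalk_cost (\<lambda>_. 1) p = length p" for p :: "('a \<times> 'a) list"
    by (induction p) auto
  have d: "?d = (INF p\<in>{p. awalk u p v}. ereal (real (length p)))"
    by (simp add: graph_dist_def \<mu>_def cost)
  have up: "?d \<le> ereal (real (length p))" if "awalk u p v" for p
    unfolding d using that by (intro INF_lower) auto
  have w0: "awalk u [] v \<longleftrightarrow> u = v" using uv by (auto simp: awalk_Nil_iff)
  have w1: "awalk u [e] v \<longleftrightarrow> e = (u, v) \<and> (u, v) \<in> parcs G" for e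
    using uv by (cases e) (auto simp: awalk_Cons_iff awalk_Nil_iff)
  have w2: "awalk u [e, e'] v \<longleftrightarrow> (\<exists>w. e = (u, w) \<and> e' = (w, v) \<and> (u, w) \<in> parcs G \<and> (w, v) \<in> parcs G)"
    for e e'
    using uv by (cases e; cases e') (auto simp: awalk_Cons_iff awalk_Nil_iff)
  show ?thesis
  proof
    assume d2: "?d = 2"
    \<comment> \<open>An infimum below 3 is witnessed by an actual walk of length at most 2.\<close>
    then have "(INF p\<in>{p. awalk u p v}. ereal (real (length p))) < 3"
      unfolding d by simp
    then obtain p where p: "awalk u p v" "ereal (real (length p)) < 3"
      by (auto simp: INF_less_iff)
    then have len: "length p < 3" by simp
    have n0: "u \<noteq> v" using up[of "[]"] d2 by (auto simp: w0)
    have n1: "(u, v) \<notin> parcs G"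
    proof
      assume "(u, v) \<in> parcs G"
      then have "?d \<le> ereal (real (length [(u, v)]))" by (intro up) (simp add: w1)
      then show False using d2 by (simp add: one_ereal_def[symmetric])
    qed
    have "p \<noteq> []" using p w0 n0 by auto
    moreover have "p \<noteq> [e]" for e using p w1[of e] n1 by blast
    ultimately obtain e e' where "p = [e, e']"
      using len by (cases p; cases "tl p"; cases "tl (tl p)") auto
    then show "u \<noteq> v \<and> (u, v) \<notin> parcs G \<and> (\<exists>w. (u, w) \<in> parcs G \<and> (w, v) \<in> parcs G)"
      using n0 n1 p w2 by auto
  next
    assume a: "u \<noteq> v \<and> (u, v) \<notin> parcs G \<and> (\<exists>w. (u, w) \<in> parcs G \<and> (w, v) \<in> parcs G)"
    then obtain w where "(u, w) \<in> parcs G" "(w, v) \<in> parcs G" by auto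
    then have "?d \<le> ereal (real (length [(u, w), (w, v)]))"
      by (intro up) (simp add: w2)
    then have le: "?d \<le> 2" by simp
    have "2 \<le> length p" if "awalk u p v" for p
      using that a w0 w1 by (cases p; cases "tl p") auto
    then have "2 \<le> ?d" unfolding d by (intro INF_greatest) (simp add: numeral_le_real_of_nat_iff)
    with le show "?d = 2" by simp
  qed
qed

lemma parcs_graph_square: "parcs (graph_square G) = within2 (parcs G)"
proof -
  have "(u, v) \<in> parcs (graph_square G) \<longleftrightarrow> (u, v) \<in> within2 (parcs G)" for u v
  proof (cases "u \<in> pverts G \<and> v \<in> pverts G")
    case True
    then show ?thesis unfolding graph_square_def within2_def
      using graph_dist_eq_2_iff[of u v] by (auto dest: no_loops')
  next
    case False
    then show ?thesis unfolding graph_square_def within2_def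
      by (auto dest: in_arcsD1 in_arcsD2)
  qed
  then show ?thesis by auto
qed

lemma pverts_graph_square: "pverts (graph_square G) = pverts G"
  by (simp add: graph_square_def)

end

section \<open>Quadratic forms written as sums over index pairs\<close>

lemma sum_pairs_symmetric:
  fixes f :: "nat \<Rightarrow> real"
  assumes "finite F" "F \<subseteq> {(i, j). i < j}"
  shows "(\<Sum>(i, j)\<in>F \<union> F\<inverse>. f i * f j) = 2 * (\<Sum>(i, j)\<in>F. f i * f j)"
proof -
  have "i < j" if "(i, j) \<in> F" for i j using assms(2) that by auto
  then have "(i, j) \<in> F \<Longrightarrow> (j, i) \<notin> F" for i j by (meson less_asym)
  then have "F \<inter> F\<inverse> = {}" by auto
  then have "(\<Sum>(i, j)\<in>F \<union> F\<inverse>. f i * f j) = (\<Sum>(i, j)\<in>F. f i * f j) + (\<Sum>(i, j)\<in>F\<inverse>. f i * f j)"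
    using assms by (intro sum.union_disjoint) auto
  also have "(\<Sum>(i, j)\<in>F\<inverse>. f i * f j) = (\<Sum>(i, j)\<in>F. f i * f j)"
    by (rule sum.reindex_bij_witness[of _ prod.swap prod.swap]) (auto simp: mult.commute)
  finally show ?thesis by simp
qed

lemma quad_index:
  fixes f :: "nat \<Rightarrow> real"
  shows "(\<Sum>i<n. \<Sum>j<n. if R i j then f i * f j else 0)
    = (\<Sum>(i, j)\<in>{(i, j). i < n \<and> j < n \<and> R i j}. f i * f j)"
proof -
  have "(\<Sum>i<n. \<Sum>j<n. if R i j then f i * f j else 0)
      = (\<Sum>p\<in>{..<n} \<times> {..<n}. if (\<lambda>(i, j). R i j) p then (\<lambda>(i, j). f i * f j) p else 0)"
    by (simp only: sum.cartesian_product) (auto intro: sum.cong)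
  also have "\<dots> = (\<Sum>p\<in>{p \<in> {..<n} \<times> {..<n}. (\<lambda>(i, j). R i j) p}. (\<lambda>(i, j). f i * f j) p)"
    by (rule sum.inter_filter[symmetric]) auto
  also have "{p \<in> {..<n} \<times> {..<n}. (\<lambda>(i, j). R i j) p} = {(i, j). i < n \<and> j < n \<and> R i j}"
    by auto
  finally show ?thesis by simp
qed

text \<open>The weights are extended by 0 to the vertices that \<open>r\<close> does not list, and
  edges outside \<open>F\<close> are dropped, which only loses nonnegative terms. \<open>F\<close>
  holds each edge once while the form counts both orientations, hence the factor 2.\<close>

lemma graph_spectral_radius_lower:
  fixes f :: "nat \<Rightarrow> real"
  assumes fin: "finite (pverts G)" and sym: "sym (parcs G)"
    and r: "inj_on r {..<n}" "r ` {..<n} \<subseteq> pverts G"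
    and f: "\<And>i. i < n \<Longrightarrow> 0 \<le> f i"
    and F: "F \<subseteq> {(i, j). i < j \<and> j < n}" "\<And>i j. (i, j) \<in> F \<Longrightarrow> (r i, r j) \<in> parcs G"
  shows "2 * (\<Sum>(i, j)\<in>F. f i * f j) \<le> graph_spectral_radius G * (\<Sum>i<n. (f i)\<^sup>2)"
proof (cases "n = 0")
  case True
  with F(1) have "F = {}" by auto
  with True show ?thesis by simp
next
  case False
  then have ne: "pverts G \<noteq> {}" using r by auto
  let ?V = "pverts G" and ?R = "r ` {..<n}"
  define g where "g v = (if v \<in> ?R then f (the_inv_into {..<n} r v) else 0)" for v
  have g: "g (r i) = f i" if "i < n" for i
    using that r by (auto simp: g_def the_inv_into_f_f)
  have "F \<subseteq> {..<n} \<times> {..<n}" using F by auto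
  then have finF: "finite F" using finite_subset by blast
  have restrict: "(\<Sum>v\<in>?V. h v) = (\<Sum>i<n. h (r i))" if "\<And>v. v \<notin> ?R \<Longrightarrow> h v = 0" for h :: "'a \<Rightarrow> real"
  proof -
    have "(\<Sum>v\<in>?V. h v) = (\<Sum>v\<in>?R. h v)"
      using that r(2) fin by (intro sum.mono_neutral_right) auto
    also have "\<dots> = (\<Sum>i<n. h (r i))" using sum.reindex[OF r(1), of h] by simp
    finally show ?thesis .
  qed
  have "2 * (\<Sum>(i, j)\<in>F. f i * f j) = (\<Sum>(i, j)\<in>F \<union> F\<inverse>. f i * f j)"
    using F by (subst sum_pairs_symmetric[OF finF]) auto
  also have "\<dots> \<le> (\<Sum>(i, j)\<in>{(i, j). i < n \<and> j < n \<and> (r i, r j) \<in> parcs G}. f i * f j)"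
  proof (rule sum_mono2)
    show "finite {(i, j). i < n \<and> j < n \<and> (r i, r j) \<in> parcs G}"
      by (rule finite_subset[of _ "{..<n} \<times> {..<n}"]) auto
    show "F \<union> F\<inverse> \<subseteq> {(i, j). i < n \<and> j < n \<and> (r i, r j) \<in> parcs G}"
      using F sym by (fastforce dest: symD)
  qed (auto simp: f)
  also have "\<dots> = (\<Sum>i<n. \<Sum>j<n. if (r i, r j) \<in> parcs G then f i * f j else 0)"
    by (rule quad_index[symmetric])
  also have "\<dots> = (\<Sum>i<n. \<Sum>j<n. if (r i, r j) \<in> parcs G then g (r i) * g (r j) else 0)"
    by (intro sum.cong refl) (auto simp: g)
  also have "\<dots> = (\<Sum>i<n. \<Sum>v\<in>?V. if (r i, v) \<in> parcs G then g (r i) * g v else 0)"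
    by (subst restrict) (auto simp: g_def)
  also have "\<dots> = quad ?V (parcs G) g"
    unfolding quad_def by (rule restrict[symmetric]) (auto simp: g_def)
  also have "\<dots> \<le> graph_spectral_radius G * (\<Sum>v\<in>?V. (g v)\<^sup>2)"
    by (rule graph_spectral_radius_eigenvector[OF fin ne sym])
  also have "(\<Sum>v\<in>?V. (g v)\<^sup>2) = (\<Sum>i<n. (f i)\<^sup>2)"
    using restrict[of "\<lambda>v. (g v)\<^sup>2"] by (simp add: g) (simp add: g_def)
  finally show ?thesis .
qed

lemma graph_spectral_radius_eigenvector_index:
  assumes bij: "bij_betw r {..<n} (pverts G)" and n: "n > 0" and sym: "sym (parcs G)"
    and R: "\<And>i j. i < n \<Longrightarrow> j < n \<Longrightarrow> (r i, r j) \<in> parcs G \<longleftrightarrow> R i j"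
  obtains f :: "nat \<Rightarrow> real" where "\<And>i. 0 \<le> f i" "(\<Sum>i<n. (f i)\<^sup>2) = 1"
    "\<And>i. i < n \<Longrightarrow> (\<Sum>j<n. if R i j then f j else 0) = graph_spectral_radius G * f i"
proof -
  have fin: "finite (pverts G)" using bij bij_betw_finite by blast
  have ne: "pverts G \<noteq> {}" using bij n by (auto simp: bij_betw_def)
  show ?thesis
  proof (rule graph_spectral_radius_eigenvector[OF fin ne sym])
    fix f assume f: "\<And>v. 0 \<le> f v" "(\<Sum>v\<in>pverts G. (f v)\<^sup>2) = 1"
      "\<And>u. u \<in> pverts G \<Longrightarrow> nbr_sum (pverts G) (parcs G) f u = graph_spectral_radius G * f u"
    show ?thesis
    proof (rule that[of "f \<circ> r"])
      show "(\<Sum>i<n. ((f \<circ> r) i)\<^sup>2) = 1"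
        using f(2) sum.reindex_bij_betw[OF bij, of "\<lambda>v. (f v)\<^sup>2"] by simp
      fix i assume i: "i < n"
      then have "r i \<in> pverts G" using bij by (auto simp: bij_betw_def)
      from f(3)[OF this] have "graph_spectral_radius G * f (r i) =
          (\<Sum>j<n. if (r i, r j) \<in> parcs G then f (r j) else 0)"
        unfolding nbr_sum_def sum.reindex_bij_betw[OF bij, symmetric] by simp
      also have "\<dots> = (\<Sum>j<n. if R i j then (f \<circ> r) j else 0)"
        using i by (intro sum.cong refl) (auto simp: R)
      finally show "(\<Sum>j<n. if R i j then (f \<circ> r) j else 0) = graph_spectral_radius G * (f \<circ> r) i"
        by simp
    qed (simp add: f)
  qed
qed

section \<open>The square of the extremal graph\<close>

definition lasso_edges :: "nat \<Rightarrow> (nat \<times> nat) set" where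
  "lasso_edges n = {(i, j). i < j \<and> j < n \<and> (j \<le> i + 2 \<or> i = 0 \<and> j = 3)}"

lemma lasso_edges_iff: "(i, j) \<in> lasso_edges n \<longleftrightarrow> i < j \<and> j < n \<and> (j \<le> i + 2 \<or> i = 0 \<and> j = 3)"
  by (simp add: lasso_edges_def)

lemma finite_lasso_edges [simp]: "finite (lasso_edges n)"
  by (rule finite_subset[of _ "{..<n} \<times> {..<n}"]) (auto simp: lasso_edges_def)

lemma lasso_edges_Suc:
  assumes "n \<ge> 4"
  shows "lasso_edges (Suc n) = lasso_edges n \<union> {(n - 1, n), (n - 2, n)}"
  using assms by (auto simp: lasso_edges_def)

lemma lasso_edges_4: "lasso_edges 4 = {(0, 1), (0, 2), (0, 3), (1, 2), (1, 3), (2, 3)}"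
  by (auto simp: lasso_edges_def)

lemma sum_lasso_edges_Suc:
  fixes g :: "nat \<times> nat \<Rightarrow> real"
  assumes "n \<ge> 4"
  shows "sum g (lasso_edges (Suc n)) = sum g (lasso_edges n) + g (n - 1, n) + g (n - 2, n)"
proof -
  have "sum g (lasso_edges (Suc n)) = sum g (lasso_edges n) + sum g {(n - 1, n), (n - 2, n)}"
    unfolding lasso_edges_Suc[OF assms]
    by (intro sum.union_disjoint finite_lasso_edges) (auto simp: lasso_edges_def)
  then show ?thesis using assms by simp
qed

text \<open>The all-ones vector needs 2 n edges on n vertices to give radius 4, so the squared lasso
  is two edges short. The later edge counts make up this deficit.\<close>

lemma card_lasso_edges: "n \<ge> 4 \<Longrightarrow> real (card (lasso_edges n)) = 2 * real n - 2"
proof (induction n rule: dec_induct)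
  case base
  then show ?case by (simp add: lasso_edges_4)
next
  case (step n)
  then show ?case using sum_lasso_edges_Suc[of n "\<lambda>_. 1"] by simp
qed

text \<open>The square of a triangle with a pendant path, its vertices listed along a Hamiltonian path that
  starts at a triangle vertex of degree two.\<close>

locale squared_lasso =
  fixes H :: "'a pair_pre_digraph" and n :: nat and r :: "nat \<Rightarrow> 'a"
  assumes n4: "n \<ge> 4" and bij: "bij_betw r {..<n} (pverts H)" and sym: "sym (parcs H)"
    and arcs: "\<And>i j. i < n \<Longrightarrow> j < n \<Longrightarrow>
      (r i, r j) \<in> parcs H \<longleftrightarrow> (i, j) \<in> lasso_edges n \<or> (j, i) \<in> lasso_edges n"
begin

text \<open>A nonnegative eigenvector that vanishes at a vertex vanishes at all its neighbours.
  Consecutive indices are adjacent, so a zero would spread down to index 0 and from there to all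
  indices, against norm 1.\<close>

lemma perron_vector:
  obtains f where "\<And>i. i < n \<Longrightarrow> 0 < f i"
    "\<And>i. i < n \<Longrightarrow> (\<Sum>j<n. if (i, j) \<in> lasso_edges n \<or> (j, i) \<in> lasso_edges n then f j else 0)
       = graph_spectral_radius H * f i"
    "2 * (\<Sum>(i, j)\<in>lasso_edges n. f i * f j) = graph_spectral_radius H * (\<Sum>i<n. (f i)\<^sup>2)"
proof -
  let ?R = "\<lambda>i j. (i, j) \<in> lasso_edges n \<or> (j, i) \<in> lasso_edges n"
  have n0: "n > 0" using n4 by simp
  show ?thesis
  proof (rule graph_spectral_radius_eigenvector_index[OF bij n0 sym arcs, simplified])
    fix f :: "nat \<Rightarrow> real"
    assume f: "\<And>i. 0 \<le> f i" "(\<Sum>i<n. (f i)\<^sup>2) = 1"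
      "\<And>i. i < n \<Longrightarrow> (\<Sum>j<n. if ?R i j then f j else 0) = graph_spectral_radius H * f i"
    have nbr0: "f j = 0" if "f i = 0" "i < n" "j < n" "?R i j" for i j
    proof -
      have "(\<Sum>j<n. if ?R i j then f j else 0) = 0" using f(3)[OF that(2)] that by simp
      then have "(if ?R i j then f j else 0) = 0"
        using that(3) f(1) by (subst (asm) sum_nonneg_eq_0_iff) (simp_all add: Ball_def)
      then show ?thesis using that by simp
    qed
    have step: "(i, Suc i) \<in> lasso_edges n" if "Suc i < n" for i
      using that by (auto simp: lasso_edges_def)
    have pos: "0 < f i" if "i < n" for i
    proof (rule ccontr)
      assume "\<not> 0 < f i"
      then have fi: "f i = 0" using f(1)[of i] by linarith
      have "f 0 = 0" using that fi
      proof (induction i)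
        case (Suc i)
        then show ?case using nbr0[of "Suc i" i] step[of i] by simp
      qed simp
      have "f k = 0" if "k < n" for k using that
      proof (induction k)
        case (Suc k)
        then show ?case using nbr0[of k "Suc k"] step[of k] by simp
      qed (simp add: \<open>f 0 = 0\<close>)
      then have "(\<Sum>i<n. (f i)\<^sup>2) = 0" by simp
      then show False using f(2) by simp
    qed
    have "2 * (\<Sum>(i, j)\<in>lasso_edges n. f i * f j)
        = (\<Sum>(i, j)\<in>lasso_edges n \<union> (lasso_edges n)\<inverse>. f i * f j)"
      by (rule sum_pairs_symmetric[symmetric, OF finite_lasso_edges]) (auto simp: lasso_edges_def)
    also have "lasso_edges n \<union> (lasso_edges n)\<inverse> = {(i, j). i < n \<and> j < n \<and> ?R i j}"
      by (auto simp: lasso_edges_def)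
    also have "(\<Sum>(i, j)\<in>\<dots>. f i * f j) = (\<Sum>i<n. \<Sum>j<n. if ?R i j then f i * f j else 0)"
      by (rule quad_index[symmetric])
    also have "\<dots> = (\<Sum>i<n. f i * (\<Sum>j<n. if ?R i j then f j else 0))"
      unfolding sum_distrib_left by (intro sum.cong refl) auto
    also have "\<dots> = (\<Sum>i<n. graph_spectral_radius H * (f i)\<^sup>2)"
      by (intro sum.cong refl) (simp add: f(3) power2_eq_square)
    finally have "2 * (\<Sum>(i, j)\<in>lasso_edges n. f i * f j) = graph_spectral_radius H * (\<Sum>i<n. (f i)\<^sup>2)"
      by (simp add: sum_distrib_left)
    with pos f(3) show ?thesis by (intro that[of f]) simp_all
  qed
qed

text \<open>The weights \<open>3, 3, 4, 5, 5, \<dots>\<close> form a positive vector \<open>h\<close> with \<open>A h \<le> 4 h\<close>, strictly at the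
  last vertex.\<close>

lemma radius_less_4:
  assumes n5: "n \<ge> 5"
  shows "graph_spectral_radius H < 4"
proof (rule perron_vector)
  let ?R = "\<lambda>i j. (i, j) \<in> lasso_edges n \<or> (j, i) \<in> lasso_edges n"
  \<comment> \<open>With a constant tail 5, equality in rows 2 and 3 of A h = 4 h and equal values
    at 0 and 1 force 3, 3, 4; rows 0 and 1 then balance as well. Row 4 has 19 < 20, and later rows
    have at most four neighbours of weight 5.\<close>
  define h :: "nat \<Rightarrow> real" where "h i = (if i < 2 then 3 else if i = 2 then 4 else 5)" for i
  fix f assume pos: "\<And>i. i < n \<Longrightarrow> 0 < f i"
    and f: "\<And>i. i < n \<Longrightarrow> (\<Sum>j<n. if ?R i j then f j else 0) = graph_spectral_radius H * f i"
  have bound: "(\<Sum>i<n. if ?R i j then h i else 0) \<le> sum h S"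
    if "finite S" "\<And>i. i < n \<Longrightarrow> ?R i j \<Longrightarrow> i \<in> S" for j S
  proof -
    have "(\<Sum>i<n. if ?R i j then h i else 0) = sum h {i \<in> {..<n}. ?R i j}"
      by (rule sum.inter_filter[symmetric]) simp
    also have "\<dots> \<le> sum h S" using that by (intro sum_mono2) (auto simp: h_def)
    finally show ?thesis .
  qed
  have super: "(\<Sum>i<n. if ?R i j then h i else 0) \<le> 4 * h j" if "j < n" for j
  proof -
    consider "j = 0" | "j = 1" | "j = 2" | "j = 3" | "j = 4" | "j \<ge> 5" by linarith
    then show ?thesis
    proof cases
      case 1
      have "(\<Sum>i<n. if ?R i j then h i else 0) \<le> sum h {1, 2, 3}"
        by (intro bound) (auto simp: lasso_edges_def 1)
      then show ?thesis by (simp add: h_def 1)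
    next
      case 2
      have "(\<Sum>i<n. if ?R i j then h i else 0) \<le> sum h {0, 2, 3}"
        by (intro bound) (auto simp: lasso_edges_def 2)
      then show ?thesis by (simp add: h_def 2)
    next
      case 3
      have "(\<Sum>i<n. if ?R i j then h i else 0) \<le> sum h {0, 1, 3, 4}"
        by (intro bound) (auto simp: lasso_edges_def 3)
      then show ?thesis by (simp add: h_def 3)
    next
      case 4
      have "(\<Sum>i<n. if ?R i j then h i else 0) \<le> sum h {0, 1, 2, 4, 5}"
        by (intro bound) (auto simp: lasso_edges_def 4)
      then show ?thesis by (simp add: h_def 4)
    next
      case 5
      have "(\<Sum>i<n. if ?R i j then h i else 0) \<le> sum h {2, 3, 5, 6}"
        by (intro bound) (auto simp: lasso_edges_def 5)
      then show ?thesis by (simp add: h_def 5)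
    next
      case 6
      have "(\<Sum>i<n. if ?R i j then h i else 0) \<le> sum h {j - 2, j - 1, j + 1, j + 2}"
        by (intro bound) (use 6 in \<open>auto simp: lasso_edges_def\<close>)
      also have "\<dots> \<le> real (card {j - 2, j - 1, j + 1, j + 2}) * 5"
        by (rule sum_bounded_above) (auto simp: h_def)
      also have "\<dots> \<le> 4 * 5"
        by (intro mult_right_mono) (auto simp: card_insert_if)
      finally show ?thesis using 6 by (simp add: h_def)
    qed
  qed
  have strict: "(\<Sum>i<n. if ?R i (n - 1) then h i else 0) < 4 * h (n - 1)"
  proof -
    have "(\<Sum>i<n. if ?R i (n - 1) then h i else 0) \<le> sum h {n - 2, n - 3}"
      by (intro bound) (use n5 in \<open>auto simp: lasso_edges_def\<close>)
    also have "\<dots> < 4 * h (n - 1)" using n5 by (auto simp: h_def)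
    finally show ?thesis .
  qed
  \<comment> \<open>Pairing \<open>h\<close> with the Perron vector and moving the symmetric matrix
    onto \<open>h\<close> transfers the row bounds to the radius. Strictness at n - 1 survives
    because the Perron vector is positive there.\<close>
  have "graph_spectral_radius H * (\<Sum>i<n. h i * f i)
      = (\<Sum>i<n. h i * (\<Sum>j<n. if ?R i j then f j else 0))"
    unfolding sum_distrib_left[of "graph_spectral_radius H"]
    by (intro sum.cong refl) (simp add: f)
  also have "\<dots> = (\<Sum>i<n. \<Sum>j<n. if ?R i j then h i * f j else 0)"
    unfolding sum_distrib_left by (intro sum.cong refl) auto
  also have "\<dots> = (\<Sum>j<n. \<Sum>i<n. if ?R i j then h i * f j else 0)"
    by (rule sum.swap)
  also have "\<dots> = (\<Sum>j<n. (\<Sum>i<n. if ?R i j then h i else 0) * f j)"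
    unfolding sum_distrib_right by (intro sum.cong refl) auto
  also have "\<dots> < (\<Sum>j<n. 4 * h j * f j)"
  proof (rule sum_strict_mono_ex1)
    show "\<forall>j\<in>{..<n}. (\<Sum>i<n. if ?R i j then h i else 0) * f j \<le> 4 * h j * f j"
      using super pos by (auto intro!: mult_right_mono less_imp_le)
    show "\<exists>j\<in>{..<n}. (\<Sum>i<n. if ?R i j then h i else 0) * f j < 4 * h j * f j"
      using strict pos n5 by (intro bexI[of _ "n - 1"]) (auto intro!: mult_strict_right_mono)
  qed simp
  also have "\<dots> = 4 * (\<Sum>i<n. h i * f i)" by (simp add: sum_distrib_left mult.assoc)
  finally have "graph_spectral_radius H * (\<Sum>i<n. h i * f i) < 4 * (\<Sum>i<n. h i * f i)" .
  moreover have "(\<Sum>i<n. h i * f i) \<ge> 0"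
    using pos by (intro sum_nonneg) (auto simp: h_def intro: less_imp_le)
  ultimately show ?thesis by (meson mult_right_mono not_le)
qed

end

section \<open>Lassos and isomorphism\<close>

lemma digraph_isoI:
  assumes "pair_wf_digraph G" "pair_wf_digraph H" and bij: "bij_betw \<phi> (pverts G) (pverts H)"
    and arcs: "\<And>u v. u \<in> pverts G \<Longrightarrow> v \<in> pverts G \<Longrightarrow> (u, v) \<in> parcs G \<longleftrightarrow> (\<phi> u, \<phi> v) \<in> parcs H"
  shows "digraph_iso (with_proj G) (with_proj H)"
proof -
  interpret G: pair_wf_digraph G by fact
  interpret H: pair_wf_digraph H by fact
  define \<psi> where "\<psi> = \<lparr>iso_verts = \<phi>, iso_arcs = map_prod \<phi> \<phi>, iso_head = snd, iso_tail = fst\<rparr>"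
  have inj: "inj_on \<phi> (pverts G)" and im: "\<phi> ` pverts G = pverts H"
    using bij by (auto simp: bij_betw_def)
  have "inj_on (map_prod \<phi> \<phi>) (pverts G \<times> pverts G)"
    using inj by (auto intro!: map_prod_inj_on)
  then have "inj_on (map_prod \<phi> \<phi>) (parcs G)"
    by (rule inj_on_subset) (auto dest: G.in_arcsD1 G.in_arcsD2)
  then have "pre_digraph.digraph_isomorphism (with_proj G) \<psi>"
    unfolding pre_digraph.digraph_isomorphism_def
    using inj G.wf_digraph_axioms by (simp add: \<psi>_def)
  moreover have "map_prod \<phi> \<phi> ` parcs G = parcs H"
  proof (intro equalityI subsetI)
    fix p assume "p \<in> map_prod \<phi> \<phi> ` parcs G"
    then obtain u v where "p = (\<phi> u, \<phi> v)" "(u, v) \<in> parcs G" by auto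
    then show "p \<in> parcs H" using arcs[of u v] G.in_arcsD1[of u v] G.in_arcsD2[of u v] by simp
  next
    fix p assume p: "p \<in> parcs H"
    obtain x y where xy: "p = (x, y)" by (cases p)
    then have "x \<in> \<phi> ` pverts G" "y \<in> \<phi> ` pverts G"
      using p H.in_arcsD1 H.in_arcsD2 im by auto
    then obtain u v where "x = \<phi> u" "y = \<phi> v" "u \<in> pverts G" "v \<in> pverts G" by auto
    then show "p \<in> map_prod \<phi> \<phi> ` parcs G" using xy p arcs[of u v] by (auto intro: rev_image_eqI)
  qed
  then have "with_proj H = app_iso \<psi> (with_proj G)"
    by (auto simp: with_proj_def app_iso_def \<psi>_def im)
  ultimately show ?thesis unfolding digraph_iso_def by blast
qed

text \<open>Arcs are pairs with \<open>fst\<close> and \<open>snd\<close> as tail and head on both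
  sides, so the arc map of an isomorphism is determined by its vertex map.\<close>

lemma digraph_isoE:
  assumes "digraph_iso (with_proj G) (with_proj H)"
  obtains \<phi> where "bij_betw \<phi> (pverts G) (pverts H)" "parcs H = map_prod \<phi> \<phi> ` parcs G"
proof -
  obtain \<psi> where iso: "pre_digraph.digraph_isomorphism (with_proj G) \<psi>"
    and H: "with_proj H = app_iso \<psi> (with_proj G)"
    using assms by (auto simp: digraph_iso_def)
  have H': "pverts H = iso_verts \<psi> ` pverts G" "parcs H = iso_arcs \<psi> ` parcs G"
    "iso_tail \<psi> = fst" "iso_head \<psi> = snd"
    using H by (auto simp: with_proj_def app_iso_def)
  have "iso_arcs \<psi> e = map_prod (iso_verts \<psi>) (iso_verts \<psi>) e" if "e \<in> parcs G" for e
    using iso that unfolding pre_digraph.digraph_isomorphism_def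
    by (auto simp: H' intro!: prod_eqI)
  then have "parcs H = map_prod (iso_verts \<psi>) (iso_verts \<psi>) ` parcs G"
    unfolding H' by (intro image_cong) auto
  moreover have "bij_betw (iso_verts \<psi>) (pverts G) (pverts H)"
    using iso unfolding pre_digraph.digraph_isomorphism_def by (auto simp: H' bij_betw_def)
  ultimately show ?thesis by (rule that[rotated])
qed

text \<open>The path \<open>0, 1, \<dots>, n - 1\<close> with the additional edge from \<open>0\<close> to \<open>k - 1\<close>; the graph \<open>W\<close> is the case
  \<open>k = 3\<close> and the cycle the case \<open>k = n\<close>.\<close>

definition chord_rel :: "nat \<Rightarrow> nat \<Rightarrow> nat \<Rightarrow> bool" where
  "chord_rel k i j \<longleftrightarrow> j = Suc i \<or> i = Suc j \<or> i = 0 \<and> Suc j = k \<or> j = 0 \<and> Suc i = k"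

definition is_lasso :: "'a pair_pre_digraph \<Rightarrow> nat \<Rightarrow> nat \<Rightarrow> (nat \<Rightarrow> 'a) \<Rightarrow> bool" where
  "is_lasso G n k r \<longleftrightarrow> bij_betw r {..<n} (pverts G) \<and>
    parcs G = {(r i, r j) | i j. i < n \<and> j < n \<and> chord_rel k i j}"

lemma is_lasso_arc_iff:
  assumes "is_lasso G n k r" "i < n" "j < n"
  shows "(r i, r j) \<in> parcs G \<longleftrightarrow> chord_rel k i j"
proof -
  have "inj_on r {..<n}" using assms by (auto simp: is_lasso_def bij_betw_def)
  then show ?thesis using assms unfolding is_lasso_def by (auto dest: inj_onD)
qed

lemma pair_graph_lasso:
  assumes "is_lasso G n k r" "k \<ge> 3"
  shows "pair_graph G"
proof
  note l = assms(1)[unfolded is_lasso_def]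
  have sub: "parcs G \<subseteq> pverts G \<times> pverts G"
    using l by (auto simp: bij_betw_def)
  show "fst e \<in> pverts G" "snd e \<in> pverts G" if "e \<in> parcs G" for e
    using that sub by auto
  show fin: "finite (pverts G)" using l bij_betw_finite by blast
  show "finite (parcs G)" using sub fin finite_subset by blast
  show "fst e \<noteq> snd e" if "e \<in> parcs G" for e
  proof -
    obtain i j where e: "e = (r i, r j)" "i < n" "j < n" "chord_rel k i j"
      using l \<open>e \<in> parcs G\<close> by auto
    have "i \<noteq> j" using e(4) assms(2) by (auto simp: chord_rel_def)
    then show ?thesis using e l by (auto simp: bij_betw_def inj_on_def)
  qed
  show "symmetric (with_proj G)"
  proof -
    have "chord_rel k i j \<Longrightarrow> chord_rel k j i" for i j by (auto simp: chord_rel_def)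
    then show ?thesis using l unfolding symmetric_def by (auto intro!: symI)
  qed
qed

lemma digraph_iso_lassos:
  assumes "is_lasso G n k r" "is_lasso H n k s" "k \<ge> 3"
  shows "digraph_iso (with_proj G) (with_proj H)"
proof -
  interpret G: pair_graph G by (rule pair_graph_lasso) fact+
  interpret H: pair_graph H by (rule pair_graph_lasso) fact+
  have br: "bij_betw r {..<n} (pverts G)" and bs: "bij_betw s {..<n} (pverts H)"
    using assms by (auto simp: is_lasso_def)
  let ?\<phi> = "s \<circ> the_inv_into {..<n} r"
  have \<phi>: "?\<phi> (r i) = s i" if "i < n" for i
    using that br by (simp add: the_inv_into_f_f bij_betw_def)
  show ?thesis
  proof (rule digraph_isoI)
    show "pair_wf_digraph G" "pair_wf_digraph H" by unfold_locales
    show "bij_betw ?\<phi> (pverts G) (pverts H)"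
      by (rule bij_betw_trans[OF bij_betw_the_inv_into[OF br] bs])
    fix u v assume "u \<in> pverts G" "v \<in> pverts G"
    then have "u \<in> r ` {..<n}" "v \<in> r ` {..<n}" using br by (simp_all add: bij_betw_def)
    then obtain i j where "u = r i" "v = r j" "i < n" "j < n" by auto
    then show "(u, v) \<in> parcs G \<longleftrightarrow> (?\<phi> u, ?\<phi> v) \<in> parcs H"
      using \<phi> is_lasso_arc_iff[OF assms(1)] is_lasso_arc_iff[OF assms(2)] by simp
  qed
qed

text \<open>Pulls a listing back along an isomorphism. Together with
  \<open>digraph_iso_lassos\<close>, isomorphism to \<open>W\<close> becomes the existence of a
  listing with k = 3.\<close>

lemma is_lasso_iso:
  assumes "digraph_iso (with_proj G) (with_proj H)" "is_lasso H n k r" "pair_wf_digraph G"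
  obtains s where "is_lasso G n k s"
proof -
  interpret G: pair_wf_digraph G by fact
  obtain \<phi> where \<phi>: "bij_betw \<phi> (pverts G) (pverts H)" "parcs H = map_prod \<phi> \<phi> ` parcs G"
    using digraph_isoE[OF assms(1)] by blast
  have br: "bij_betw r {..<n} (pverts H)" using assms by (auto simp: is_lasso_def)
  define s where "s = the_inv_into (pverts G) \<phi> \<circ> r"
  have bs: "bij_betw s {..<n} (pverts G)"
    unfolding s_def by (rule bij_betw_trans[OF br bij_betw_the_inv_into[OF \<phi>(1)]])
  have \<phi>s: "\<phi> (s i) = r i" if "i < n" for i
    using that f_the_inv_into_f_bij_betw[OF \<phi>(1), of "r i"] bij_betw_apply[OF br, of i]
    by (simp add: s_def)
  have "(u, v) \<in> parcs G \<longleftrightarrow> (\<phi> u, \<phi> v) \<in> parcs H" if "u \<in> pverts G" "v \<in> pverts G" for u v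
  proof
    assume "(\<phi> u, \<phi> v) \<in> parcs H"
    then obtain x y where xy: "(x, y) \<in> parcs G" "\<phi> u = \<phi> x" "\<phi> v = \<phi> y"
      using \<phi>(2) by auto
    then have "u = x" "v = y"
      using that \<phi>(1) G.in_arcsD1 G.in_arcsD2 by (auto simp: bij_betw_def inj_on_def)
    with xy show "(u, v) \<in> parcs G" by simp
  qed (use \<phi>(2) in force)
  then have arc: "(s i, s j) \<in> parcs G \<longleftrightarrow> chord_rel k i j" if "i < n" "j < n" for i j
    using that bs by (simp add: \<phi>s is_lasso_arc_iff[OF assms(2)] bij_betw_apply)
  have "parcs G = {(s i, s j) | i j. i < n \<and> j < n \<and> chord_rel k i j}"
  proof (intro equalityI subsetI)
    fix e assume e: "e \<in> parcs G"
    then have "fst e \<in> s ` {..<n}" "snd e \<in> s ` {..<n}"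
      using bs G.arc_fst_in_verts G.arc_snd_in_verts by (auto simp: bij_betw_def)
    then obtain i j where "e = (s i, s j)" "i < n" "j < n" by (cases e) auto
    then show "e \<in> {(s i, s j) | i j. i < n \<and> j < n \<and> chord_rel k i j}" using e arc by blast
  qed (use arc in auto)
  with bs that show ?thesis by (auto simp: is_lasso_def)
qed

lemma squared_lasso_graph_square:
  assumes l: "is_lasso G n 3 r" and n: "n \<ge> 4"
  shows "squared_lasso (graph_square G) n r"
proof -
  interpret G: pair_graph G by (rule pair_graph_lasso[OF l]) simp
  have br: "bij_betw r {..<n} (pverts G)" using l by (auto simp: is_lasso_def)
  have inj: "r i = r j \<longleftrightarrow> i = j" if "i < n" "j < n" for i j
    using br that by (auto simp: bij_betw_def inj_on_def)
  have common: "(\<exists>w. (r i, w) \<in> parcs G \<and> (w, r j) \<in> parcs G) \<longleftrightarrow>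
      (\<exists>m<n. chord_rel 3 i m \<and> chord_rel 3 m j)" (is "?A \<longleftrightarrow> ?B") if "i < n" "j < n" for i j
  proof
    assume ?A
    then obtain w where w: "(r i, w) \<in> parcs G" "(w, r j) \<in> parcs G" by auto
    then have "w \<in> r ` {..<n}" using br G.in_arcsD1 by (auto simp: bij_betw_def)
    then show ?B using w that is_lasso_arc_iff[OF l] by auto
  qed (use that is_lasso_arc_iff[OF l] in blast)
  have idx: "i \<noteq> j \<and> (chord_rel 3 i j \<or> (\<exists>m<n. chord_rel 3 i m \<and> chord_rel 3 m j)) \<longleftrightarrow>
      (i, j) \<in> lasso_edges n \<or> (j, i) \<in> lasso_edges n" (is "?A \<longleftrightarrow> ?B") if "i < n" "j < n" for i j
  proof
    assume ?A
    then show ?B using that by (auto simp: lasso_edges_def chord_rel_def)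
  next
    assume b: ?B
    have e: "i \<noteq> j \<and> (chord_rel 3 i j \<or> (\<exists>m<n. chord_rel 3 i m \<and> chord_rel 3 m j))"
      if lt: "i < j" "j < n" and e: "(i, j) \<in> lasso_edges n" for i j
    proof -
      consider "j = Suc i" | "j = Suc (Suc i)" | "i = 0" "j = 3"
        using e lt by (force simp: lasso_edges_def)
      then show ?thesis
      proof cases
        case 2
        then show ?thesis using lt by (intro conjI disjI2 exI[of _ "Suc i"]) (auto simp: chord_rel_def)
      next
        case 3
        \<comment> \<open>The midpoint is 2, reached from 0 by the edge that closes the
          triangle.\<close>
        then show ?thesis using lt by (intro conjI disjI2 exI[of _ 2]) (auto simp: chord_rel_def)
      qed (auto simp: chord_rel_def)
    qed
    have s: "chord_rel 3 x y \<Longrightarrow> chord_rel 3 y x" for x y by (auto simp: chord_rel_def)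
    show ?A using b
    proof
      assume "(i, j) \<in> lasso_edges n"
      then show ?A using e[of i j] by (auto simp: lasso_edges_def)
    next
      assume "(j, i) \<in> lasso_edges n"
      then have "j \<noteq> i \<and> (chord_rel 3 j i \<or> (\<exists>m<n. chord_rel 3 j m \<and> chord_rel 3 m i))"
        using e[of j i] by (auto simp: lasso_edges_def)
      then show ?A using s by blast
    qed
  qed
  show ?thesis
  proof
    show "bij_betw r {..<n} (pverts (graph_square G))" using br by (simp add: G.pverts_graph_square)
    show "sym (parcs (graph_square G))"
      by (simp add: G.parcs_graph_square sym_within2 G.sym_parcs)
    show "(r i, r j) \<in> parcs (graph_square G) \<longleftrightarrow> (i, j) \<in> lasso_edges n \<or> (j, i) \<in> lasso_edges n"
      if "i < n" "j < n" for i j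
      unfolding G.parcs_graph_square within2_def
      using that by (simp add: idx[symmetric] common inj is_lasso_arc_iff[OF l])
  qed fact
qed

section \<open>The cycle and the coalescence as lassos\<close>

lemma is_lasso_cycle_graph:
  assumes "k \<ge> 3"
  shows "is_lasso (cycle_graph k) k k id"
proof -
  have "j = Suc i mod k \<or> i = Suc j mod k \<longleftrightarrow> chord_rel k i j" if "i < k" "j < k" for i j
    using that assms by (auto simp: chord_rel_def mod_Suc)
  then show ?thesis unfolding is_lasso_def cycle_graph_def by auto
qed

lemma pendant_vertex_path_graph:
  assumes "pendant_vertex (path_graph m) v" "m \<ge> 2"
  shows "v = 0 \<or> Suc v = m"
proof (rule ccontr)
  assume c: "\<not> ?thesis"
  have v: "v < m" using assms by (auto simp: pendant_vertex_def path_graph_def)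
  have "out_arcs (with_proj (path_graph m)) v = {(v, Suc v), (v, v - 1)}"
    using c v by (auto simp: out_arcs_def path_graph_def)
  then have "out_degree (with_proj (path_graph m)) v = 2"
    using c by (simp add: out_degree_def card_insert_if)
  then show False using assms by (simp add: pendant_vertex_def)
qed

lemma image_map_prod_Collect:
  "map_prod f f ` {(g i, g j) | i j. P i j} = {(f (g i), f (g j)) | i j. P i j}"
proof (intro equalityI subsetI)
  fix p assume "p \<in> {(f (g i), f (g j)) | i j. P i j}"
  then obtain i j where "p = map_prod f f (g i, g j)" "P i j" by auto
  then show "p \<in> map_prod f f ` {(g i, g j) | i j. P i j}" by blast
next
  fix p assume "p \<in> map_prod f f ` {(g i, g j) | i j. P i j}"
  then obtain i j where "p = (f (g i), f (g j))" "P i j" by auto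
  then show "p \<in> {(f (g i), f (g j)) | i j. P i j}" by blast
qed

lemma is_lasso_coalescence:
  assumes n: "n \<ge> 4" and c: "c \<in> pverts (cycle_graph 3)"
    and v: "pendant_vertex (path_graph (n - 2)) v"
  obtains r where "is_lasso (coalescence (cycle_graph 3) c (path_graph (n - 2)) v) n 3 r"
proof -
  let ?W = "coalescence (cycle_graph 3) c (path_graph (n - 2)) v"
  have c3: "c < 3" using c by (simp add: cycle_graph_def)
  have v': "v = 0 \<or> v = n - 3" using pendant_vertex_path_graph[OF v] n by fastforce
  \<comment> \<open>The identified vertex takes position 2, the last one of the triangle and the
    first one of the path: the shift by c + 1 in \<open>x\<close> sends 2 to c, and \<open>y\<close>
    reads the path forwards or backwards so that it starts at \<open>v\<close>. The index ranges of
    the two pieces therefore overlap exactly in 2.\<close>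
  define y where "y i = (if v = 0 then i - 2 else n - 1 - i)" for i
  define x where "x i = (c + 1 + i) mod 3" for i
  define f :: "nat \<Rightarrow> nat + nat" where "f = (\<lambda>y. if y = v then Inl c else Inr y)"
  define r where "r i = (if i < 3 then Inl (x i) else Inr (y i))" for i
  have yv: "y i = v \<longleftrightarrow> i = 2" if "i < n" "2 \<le> i" for i
    using that v' n by (auto simp: y_def)
  have x2: "x 2 = c" using c3 by (simp add: x_def)
  have ry: "r i = f (y i)" if "i < n" "2 \<le> i" for i
    using yv[OF that] that x2 by (auto simp: r_def f_def)
  have xb: "bij_betw x {..<3} {..<3}"
  proof -
    have "c = 0 \<or> c = 1 \<or> c = 2" using c3 by auto
    then have "x ` {0, 1, 2} = {0, 1, 2} \<and> inj_on x {0, 1, 2}" by (auto simp: x_def)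
    moreover have "{..<3::nat} = {0, 1, 2}" by auto
    ultimately show ?thesis by (simp add: bij_betw_def)
  qed
  have yb: "bij_betw y {2..<n} {..<n - 2}"
  proof (rule bij_betwI[where g = "\<lambda>j. if v = 0 then j + 2 else n - 1 - j"])
  qed (use n in \<open>auto simp: y_def\<close>)
  have vy: "pverts ?W = Inl ` {..<3} \<union> f ` {..<n - 2}"
    by (simp add: coalescence_def cycle_graph_def path_graph_def f_def Let_def)
  have split: "{..<n} = {..<3} \<union> {2..<n}" using n by auto
  have r3: "r ` {..<3} = Inl ` {..<3}"
  proof -
    have "r ` {..<3} = Inl ` (x ` {..<3})" unfolding image_image by (intro image_cong) (auto simp: r_def)
    then show ?thesis using xb by (simp add: bij_betw_def)
  qed
  have r2: "r ` {2..<n} = f ` {..<n - 2}"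
  proof -
    have "r ` {2..<n} = f ` (y ` {2..<n})" unfolding image_image by (intro image_cong) (auto simp: ry)
    then show ?thesis using yb by (simp add: bij_betw_def)
  qed
  have inj: "inj_on r {..<n}"
  proof (rule inj_onI)
    fix i j assume ij: "i \<in> {..<n}" "j \<in> {..<n}" "r i = r j"
    show "i = j"
    proof (cases "i < 3")
      case True
      then have "j < 3" "x i = x j" using ij by (auto simp: r_def split: if_splits)
      then show ?thesis using True xb by (auto simp: bij_betw_def inj_on_def)
    next
      case False
      then have "\<not> j < 3" "y i = y j" using ij by (auto simp: r_def split: if_splits)
      then show ?thesis using False ij yb by (auto simp: bij_betw_def inj_on_def)
    qed
  qed
  have bij: "bij_betw r {..<n} (pverts ?W)"
    using inj unfolding bij_betw_def vy by (simp add: split image_Un r3 r2)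
  have C: "map_prod Inl Inl ` parcs (cycle_graph 3) = {(r i, r j) | i j. i < 3 \<and> j < 3 \<and> i \<noteq> j}"
  proof -
    have "parcs (cycle_graph 3) = {(a, b). a < 3 \<and> b < 3 \<and> a \<noteq> b}"
    proof -
      have "chord_rel 3 a b \<longleftrightarrow> a \<noteq> b" if "a < 3" "b < 3" for a b
        using that by (auto simp: chord_rel_def)
      then show ?thesis using is_lasso_cycle_graph[of 3] by (auto simp: is_lasso_def)
    qed
    also have "\<dots> = {(x i, x j) | i j. i < 3 \<and> j < 3 \<and> i \<noteq> j}"
    proof (intro equalityI subsetI)
      fix p :: "nat \<times> nat" assume p: "p \<in> {(a, b). a < 3 \<and> b < 3 \<and> a \<noteq> b}"
      then have "fst p \<in> x ` {..<3}" "snd p \<in> x ` {..<3}" using xb by (auto simp: bij_betw_def)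
      then obtain i j where "p = (x i, x j)" "i < 3" "j < 3" by (cases p) auto
      then show "p \<in> {(x i, x j) | i j. i < 3 \<and> j < 3 \<and> i \<noteq> j}" using p by auto
    next
      fix p :: "nat \<times> nat" assume "p \<in> {(x i, x j) | i j. i < 3 \<and> j < 3 \<and> i \<noteq> j}"
      then obtain i j where "p = (x i, x j)" "i < 3" "j < 3" "i \<noteq> j" by auto
      then show "p \<in> {(a, b). a < 3 \<and> b < 3 \<and> a \<noteq> b}"
        using xb bij_betw_apply[OF xb, of i] bij_betw_apply[OF xb, of j]
        by (auto simp: bij_betw_def inj_on_def)
    qed
    finally show ?thesis
      by (simp only: image_map_prod_Collect) (intro Collect_cong ex_cong1, auto simp: r_def)
  qed
  have P: "map_prod f f ` parcs (path_graph (n - 2)) =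
      {(r i, r j) | i j. i < n \<and> j < n \<and> 2 \<le> i \<and> 2 \<le> j \<and> (j = Suc i \<or> i = Suc j)}"
  proof -
    have adj: "(y j = Suc (y i) \<or> y i = Suc (y j)) \<longleftrightarrow> (j = Suc i \<or> i = Suc j)"
      if "i < n" "j < n" "2 \<le> i" "2 \<le> j" for i j
      using that by (auto simp: y_def)
    have "parcs (path_graph (n - 2)) =
        {(y i, y j) | i j. i < n \<and> j < n \<and> 2 \<le> i \<and> 2 \<le> j \<and> (j = Suc i \<or> i = Suc j)}"
    proof (intro equalityI subsetI)
      fix p :: "nat \<times> nat" assume p: "p \<in> parcs (path_graph (n - 2))"
      then have "fst p \<in> y ` {2..<n}" "snd p \<in> y ` {2..<n}"
        using yb by (auto simp: bij_betw_def path_graph_def)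
      then obtain i j where "p = (y i, y j)" "i < n" "j < n" "2 \<le> i" "2 \<le> j" by (cases p) auto
      then show "p \<in> {(y i, y j) | i j. i < n \<and> j < n \<and> 2 \<le> i \<and> 2 \<le> j \<and> (j = Suc i \<or> i = Suc j)}"
        using p adj[of i j] by (auto simp: path_graph_def)
    next
      fix p :: "nat \<times> nat"
      assume "p \<in> {(y i, y j) | i j. i < n \<and> j < n \<and> 2 \<le> i \<and> 2 \<le> j \<and> (j = Suc i \<or> i = Suc j)}"
      then obtain i j where p: "p = (y i, y j)" "i < n" "j < n" "2 \<le> i" "2 \<le> j" "j = Suc i \<or> i = Suc j"
        by blast
      then show "p \<in> parcs (path_graph (n - 2))"
        using bij_betw_apply[OF yb, of i] bij_betw_apply[OF yb, of j] adj[of i j]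
        by (simp add: path_graph_def)
    qed
    then show ?thesis
      by (simp only: image_map_prod_Collect) (intro Collect_cong ex_cong1, auto simp: ry)
  qed
  have "parcs ?W = map_prod Inl Inl ` parcs (cycle_graph 3) \<union> map_prod f f ` parcs (path_graph (n - 2))"
    by (simp add: coalescence_def f_def Let_def)
  also have "\<dots> = {(r i, r j) | i j. i < n \<and> j < n \<and> chord_rel 3 i j}" (is "_ = ?R")
  proof (intro equalityI subsetI)
    fix p assume "p \<in> map_prod Inl Inl ` parcs (cycle_graph 3) \<union> map_prod f f ` parcs (path_graph (n - 2))"
    then show "p \<in> ?R"
    proof
      assume "p \<in> map_prod Inl Inl ` parcs (cycle_graph 3)"
      then obtain i j where ij: "p = (r i, r j)" "i < 3" "j < 3" "i \<noteq> j" unfolding C by auto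
      then have "chord_rel 3 i j" by (auto simp: chord_rel_def)
      moreover have "i < n" "j < n" using ij n by auto
      ultimately show ?thesis using ij(1) by blast
    next
      assume "p \<in> map_prod f f ` parcs (path_graph (n - 2))"
      then show ?thesis unfolding P by (auto simp: chord_rel_def)
    qed
  next
    fix p assume "p \<in> ?R"
    then obtain i j where ij: "p = (r i, r j)" "i < n" "j < n" "chord_rel 3 i j" by blast
    show "p \<in> map_prod Inl Inl ` parcs (cycle_graph 3) \<union> map_prod f f ` parcs (path_graph (n - 2))"
    proof (cases "i < 3 \<and> j < 3")
      case True
      then have "i \<noteq> j" using ij(4) by (auto simp: chord_rel_def)
      with ij True show ?thesis unfolding C by blast
    next
      case False
      then have "2 \<le> i \<and> 2 \<le> j \<and> (j = Suc i \<or> i = Suc j)" using ij(4) by (auto simp: chord_rel_def)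
      with ij show ?thesis unfolding P by blast
    qed
  qed
  finally show ?thesis using bij that by (simp add: is_lasso_def)
qed

section \<open>Connectedness and cycles as subgraphs\<close>

context pair_graph begin

lemma connected_arc_leaving:
  assumes conn: "Digraph_Component.connected (with_proj G)"
    and S: "S \<subseteq> pverts G" "S \<noteq> {}" "S \<noteq> pverts G"
  obtains u v where "u \<in> S" "v \<in> pverts G" "v \<notin> S" "(u, v) \<in> parcs G"
proof -
  obtain s t where st: "s \<in> S" "t \<in> pverts G" "t \<notin> S" using S by auto
  have "strongly_connected (with_proj G)"
    using conn by (intro symmetric_connected_imp_strongly_connected sym_arcs)
  then have "s \<rightarrow>\<^sup>*\<^bsub>with_proj G\<^esub> t" using st S by (auto simp: strongly_connected_def)
  have "\<exists>u v. u \<in> S \<and> v \<notin> S \<and> (u, v) \<in> parcs G"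
  proof (rule ccontr)
    assume no: "\<nexists>u v. u \<in> S \<and> v \<notin> S \<and> (u, v) \<in> parcs G"
    from \<open>s \<rightarrow>\<^sup>*\<^bsub>with_proj G\<^esub> t\<close> have "t \<in> S"
    proof (induction rule: reachable_induct)
      case (step x y)
      then show ?case using no by auto
    qed (rule st)
    with st show False by simp
  qed
  then show ?thesis using that in_arcsD2 by blast
qed

text \<open>Uniqueness in \<open>unicyclic\<close> speaks of subgraphs isomorphic to a cycle; this
  produces such a subgraph from an injective closed sequence of vertices.\<close>

lemma cycle_subgraph:
  assumes k: "k \<ge> 3" and inj: "inj_on c {..<k}" and c: "\<And>i. i < k \<Longrightarrow> (c i, c (Suc i mod k)) \<in> parcs G"
  defines "H \<equiv> \<lparr>pverts = c ` {..<k}, parcs = {(c i, c j) | i j. i < k \<and> j < k \<and> chord_rel k i j}\<rparr>"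
  shows "subgraph (with_proj H) (with_proj G)"
    and "digraph_iso (with_proj H) (with_proj (cycle_graph k))"
proof -
  have H: "is_lasso H k k c" using inj by (simp add: is_lasso_def H_def bij_betw_def)
  interpret H: pair_graph H by (rule pair_graph_lasso[OF H k])
  show "digraph_iso (with_proj H) (with_proj (cycle_graph k))"
    by (rule digraph_iso_lassos[OF H is_lasso_cycle_graph[OF k] k])
  have up: "(c i, c j) \<in> parcs G" if "i < k" "j < k" "j = Suc i \<or> j = 0 \<and> Suc i = k" for i j
    using c[of i] that by auto
  have sub: "parcs H \<subseteq> parcs G"
  proof
    fix p assume "p \<in> parcs H"
    then obtain i j where p: "p = (c i, c j)" "i < k" "j < k" "chord_rel k i j" by (auto simp: H_def)
    then consider "j = Suc i \<or> j = 0 \<and> Suc i = k" | "i = Suc j \<or> i = 0 \<and> Suc j = k"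
      by (auto simp: chord_rel_def)
    then show "p \<in> parcs G"
      using up[of i j] up[of j i] p arcs_symmetric by cases auto
  qed
  have "pverts H \<subseteq> pverts G" using in_arcsD1[OF c] by (auto simp: H_def)
  with sub show "subgraph (with_proj H) (with_proj G)"
    using wf_digraph_axioms H.wf_digraph_axioms by (simp add: subgraph_def compatible_def)
qed

end

section \<open>Lassos in graphs with a cycle\<close>

text \<open>The lower bounds ask only for some cycle. In this generality they also apply to
  \<open>cycle_graph\<close> itself, with no need to show that it is unicyclic.\<close>

locale cyclic_graph = pair_graph G for G :: "'a pair_pre_digraph" +
  fixes k :: nat and c :: "nat \<Rightarrow> 'a"
  assumes k3: "k \<ge> 3"
    and c_inj: "inj_on c {..<k}"
    and c_arc: "\<And>i. i < k \<Longrightarrow> (c i, c (Suc i mod k)) \<in> parcs G"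

text \<open>Comparing vertex sets absorbs rotations and reversals of a cycle and is still enough to
  exclude a chord.\<close>

locale unicyclic_graph = cyclic_graph +
  assumes conn: "Digraph_Component.connected (with_proj G)"
    and c_unique: "\<And>l d. l \<ge> 3 \<Longrightarrow> inj_on d {..<l} \<Longrightarrow>
      (\<And>i. i < l \<Longrightarrow> (d i, d (Suc i mod l)) \<in> parcs G) \<Longrightarrow> d ` {..<l} = c ` {..<k}"

lemma unicyclicE:
  assumes "unicyclic G"
  obtains k c where "unicyclic_graph G k c"
proof -
  interpret pair_graph G using assms by (simp add: unicyclic_def)
  obtain H k where H: "subgraph (with_proj H) (with_proj G)" "k \<ge> 3"
      "digraph_iso (with_proj H) (with_proj (cycle_graph k))"
    and uniq: "\<And>H' l. subgraph (with_proj H') (with_proj G) \<Longrightarrow> l \<ge> 3 \<Longrightarrow>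
      digraph_iso (with_proj H') (with_proj (cycle_graph l)) \<Longrightarrow> H' = H"
    using assms unfolding unicyclic_def by metis
  have "pair_wf_digraph H"
    using H(1) by (simp add: subgraph_def wf_digraph_wp_iff)
  then obtain c where c: "is_lasso H k k c"
    using is_lasso_iso[OF H(3) is_lasso_cycle_graph[OF H(2)]] by blast
  have "unicyclic_graph G k c"
  proof
    show "Digraph_Component.connected (with_proj G)" using assms by (simp add: unicyclic_def)
    show "inj_on c {..<k}" using c by (simp add: is_lasso_def bij_betw_def)
    show "(c i, c (Suc i mod k)) \<in> parcs G" if "i < k" for i
    proof -
      have "chord_rel k i (Suc i mod k)" using that by (auto simp: chord_rel_def mod_Suc)
      then have "(c i, c (Suc i mod k)) \<in> parcs H" using is_lasso_arc_iff[OF c] that by simp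
      then show ?thesis using H(1) by (auto simp: subgraph_def)
    qed
    show "d ` {..<l} = c ` {..<k}" if "l \<ge> 3" "inj_on d {..<l}"
      "\<And>i. i < l \<Longrightarrow> (d i, d (Suc i mod l)) \<in> parcs G" for l d
      using uniq[OF cycle_subgraph(1)[OF that] \<open>l \<ge> 3\<close> cycle_subgraph(2)[OF that]] c
      by (auto simp: is_lasso_def bij_betw_def)
  qed fact
  then show ?thesis by (rule that)
qed

context cyclic_graph begin

abbreviation E2 :: "('a \<times> 'a) set" where "E2 \<equiv> within2 (parcs G)"
abbreviation square_radius :: real where "square_radius \<equiv> graph_spectral_radius (graph_square G)"

lemma square_radius_lower:
  fixes f :: "nat \<Rightarrow> real"
  assumes "inj_on r {..<n}" "r ` {..<n} \<subseteq> pverts G" "\<And>i. i < n \<Longrightarrow> 0 \<le> f i"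
    "F \<subseteq> {(i, j). i < j \<and> j < n}" "\<And>i j. (i, j) \<in> F \<Longrightarrow> (r i, r j) \<in> E2"
  shows "2 * (\<Sum>(i, j)\<in>F. f i * f j) \<le> square_radius * (\<Sum>i<n. (f i)\<^sup>2)"
  using assms pair_finite_verts
  by (intro graph_spectral_radius_lower)
    (auto simp: pverts_graph_square parcs_graph_square sym_within2 sym_parcs)

lemma square_radius_ge_4_ones:
  assumes "inj_on r {..<n}" "r ` {..<n} \<subseteq> pverts G" "n > 0"
    "F \<subseteq> {(i, j). i < j \<and> j < n}" "\<And>i j. (i, j) \<in> F \<Longrightarrow> (r i, r j) \<in> E2" "real (card F) \<ge> 2 * real n"
  shows "square_radius \<ge> 4"
proof -
  have "2 * real (card F) \<le> square_radius * real n"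
    using square_radius_lower[OF assms(1,2) _ assms(4,5), of "\<lambda>_. 1"] by (simp add: case_prod_beta)
  then have "4 * real n \<le> square_radius * real n" using assms(6) by simp
  then show ?thesis using assms(3) by simp
qed

text \<open>In contrast to \<open>is_lasso\<close>, further edges among the listed vertices are
  allowed and the listing need not span; \<open>k\<close> is the length of the fixed cycle.\<close>

definition lasso :: "nat \<Rightarrow> (nat \<Rightarrow> 'a) \<Rightarrow> bool" where
  "lasso L q \<longleftrightarrow> k \<le> L \<and> inj_on q {..<L} \<and> (\<forall>i. Suc i < L \<longrightarrow> (q i, q (Suc i)) \<in> parcs G) \<and>
    (q 0, q (k - 1)) \<in> parcs G"

lemma lassoD:
  assumes "lasso L q"
  shows "k \<le> L" "inj_on q {..<L}" "\<And>i. Suc i < L \<Longrightarrow> (q i, q (Suc i)) \<in> parcs G"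
    "(q 0, q (k - 1)) \<in> parcs G"
  using assms by (auto simp: lasso_def)

lemma lasso_inj: "lasso L q \<Longrightarrow> i < L \<Longrightarrow> j < L \<Longrightarrow> q i = q j \<longleftrightarrow> i = j"
  by (auto simp: lasso_def inj_on_def)

lemma lasso_verts: "lasso L q \<Longrightarrow> q ` {..<L} \<subseteq> pverts G"
proof
  fix x assume l: "lasso L q" and "x \<in> q ` {..<L}"
  then obtain i where i: "i < L" "x = q i" by auto
  show "x \<in> pverts G"
  proof (cases i)
    case 0
    then show ?thesis using i lassoD(4)[OF l] in_arcsD1 by auto
  next
    case (Suc j)
    then show ?thesis using i lassoD(3)[OF l, of j] in_arcsD2 by auto
  qed
qed

lemma lasso_length_le: "lasso L q \<Longrightarrow> L \<le> card (pverts G)"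
  using card_image[of q "{..<L}"] card_mono[OF pair_finite_verts lasso_verts, of L q]
  by (simp add: lasso_def)

lemma lasso_c: "lasso k c"
proof -
  have "(c i, c (Suc i)) \<in> parcs G" if "Suc i < k" for i using c_arc[of i] that by simp
  moreover have "(c (k - 1), c 0) \<in> parcs G" using c_arc[of "k - 1"] k3 by simp
  ultimately show ?thesis using c_inj arcs_symmetric by (auto simp: lasso_def)
qed

lemma lasso_cycle_arc:
  assumes "lasso L q" "i < k"
  shows "(q i, q (Suc i mod k)) \<in> parcs G"
proof (cases "Suc i = k")
  case True
  then show ?thesis using lassoD(4)[OF assms(1)] arcs_symmetric by auto
next
  case False
  then show ?thesis using assms lassoD(1)[OF assms(1)] lassoD(3)[OF assms(1), of i] by simp
qed

lemma maximal_lasso: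
  obtains L q where "lasso L q" "\<forall>L' q'. lasso L' q' \<longrightarrow> L' \<le> L"
proof -
  define P where "P L \<longleftrightarrow> (\<exists>q. lasso L q)" for L
  have "P k" using lasso_c by (auto simp: P_def)
  moreover have "\<forall>L. P L \<longrightarrow> L \<le> card (pverts G)" using lasso_length_le by (auto simp: P_def)
  ultimately have "P (Greatest P)" "\<And>L. P L \<Longrightarrow> L \<le> Greatest P"
    using GreatestI_nat[of P] Greatest_le_nat[of P] by blast+
  then show ?thesis using that unfolding P_def by blast
qed

lemma lasso_snoc:
  assumes "lasso L q" "(q (L - 1), u) \<in> parcs G" "u \<notin> q ` {..<L}"
  shows "lasso (Suc L) (q(L := u))"
proof -
  have "inj_on (q(L := u)) {..<Suc L}"
    using lassoD(2)[OF assms(1)] assms(3) by (auto simp: lessThan_Suc inj_on_def)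
  moreover have "((q(L := u)) i, (q(L := u)) (Suc i)) \<in> parcs G" if "Suc i < Suc L" for i
    using that assms(2) lassoD(3)[OF assms(1), of i] by (cases "Suc i = L") auto
  ultimately show ?thesis using assms(1) k3 by (auto simp: lasso_def)
qed

text \<open>The offset a + 1 makes the new listing end at \<open>q a\<close>, so that a neighbour of
  \<open>q a\<close> off the lasso can be appended.\<close>

lemma lasso_rotate:
  assumes q: "lasso L q" and a: "a < k"
  shows "lasso k (\<lambda>i. q ((a + 1 + i) mod k))" (is "lasso k ?r")
proof -
  have k0: "k > 0" using k3 by simp
  have "inj_on ?r {..<k}"
  proof (rule inj_onI)
    fix i j assume ij: "i \<in> {..<k}" "j \<in> {..<k}" "?r i = ?r j"
    have "(a + 1 + i) mod k = (a + 1 + j) mod k"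
      using ij k0 lassoD(1)[OF q] lasso_inj[OF q, of "(a + 1 + i) mod k" "(a + 1 + j) mod k"]
      by (meson mod_less_divisor order_less_le_trans)
    then have "i mod k = j mod k" by (simp add: mod_add_eq mod_eq_dvd_iff_nat nat_mod_eq_iff)
    then show "i = j" using ij by simp
  qed
  moreover have "(?r i, ?r (Suc i)) \<in> parcs G" for i
    using lasso_cycle_arc[OF q, of "(a + 1 + i) mod k"] k0 by (simp add: mod_Suc_eq)
  moreover have "(?r 0, ?r (k - 1)) \<in> parcs G"
  proof -
    have "?r (k - 1) = q a" using a k0 by simp
    moreover have "?r 0 = q (Suc a mod k)" by simp
    ultimately show ?thesis using lasso_cycle_arc[OF q a] arcs_symmetric by simp
  qed
  ultimately show ?thesis by (auto simp: lasso_def)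
qed

lemma lasso_square_near:
  assumes q: "lasso L q" and ij: "i < j" "j < L" "j \<le> i + 2"
  shows "(q i, q j) \<in> E2"
proof (cases "j = Suc i")
  case True
  then show ?thesis using lassoD(3)[OF q, of i] ij lasso_inj[OF q, of i j] by (auto intro: within2_arc)
next
  case False
  then have "j = Suc (Suc i)" using ij by simp
  then show ?thesis
    using lassoD(3)[OF q, of i] lassoD(3)[OF q, of "Suc i"] ij lasso_inj[OF q, of i j]
    by (auto intro: within2_common)
qed

lemma lasso_square_chord:
  assumes q: "lasso L q" and "k < L"
  shows "(q 0, q k) \<in> E2"
  using lassoD(3)[OF q, of "k - 1"] lassoD(4)[OF q] assms k3 lasso_inj[OF q, of 0 k]
  by (auto intro: within2_common)

text \<open>The pair {0, 3} is joined through \<open>q 2\<close> if k = 3 and is the closing edge of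
  the cycle if k = 4, so both kinds of lasso carry all edges of the square of
  \<open>W\<close>.\<close>

lemma lasso_edges_square:
  assumes q: "lasso L q" and k: "k = 3 \<or> k = 4" and ij: "(i, j) \<in> lasso_edges L"
  shows "(q i, q j) \<in> E2"
proof (cases "j \<le> i + 2")
  case True
  then show ?thesis using ij lasso_square_near[OF q] by (auto simp: lasso_edges_def)
next
  case False
  then have "i = 0" "j = 3" "3 < L" using ij by (auto simp: lasso_edges_def)
  then show ?thesis
    using k lasso_square_chord[OF q] lassoD(4)[OF q] lasso_inj[OF q, of 0 3]
    by (auto intro: within2_arc)
qed

lemma sym_E2: "(u, v) \<in> E2 \<Longrightarrow> (v, u) \<in> E2"
  using sym_within2[OF sym_parcs] by (auto dest: symD)

text \<open>The three vertices are \<open>q a\<close> and two lasso neighbours of it, a - 1 and a +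
  1, or 1 and k - 1 if a = 0. The bound \<open>M\<close> allows \<open>K\<close> to be kept away
  from the end of the lasso.\<close>

lemma attached_vertex:
  assumes q: "lasso L q" and u: "u \<notin> q ` {..<L}" "(q a, u) \<in> parcs G"
    and M: "Suc a < M" "k \<le> M" "M \<le> L"
  obtains K where "K \<subseteq> {..<M}" "card K = 3" "\<And>i. i \<in> K \<Longrightarrow> (q i, u) \<in> E2"
proof -
  have ne: "q i \<noteq> u" if "i < L" for i using u that by auto
  have via: "(q i, u) \<in> E2" if "i < L" "(q i, q a) \<in> parcs G" for i
    using that u ne by (intro within2_common[of _ "q a"]) auto
  have self: "(q a, u) \<in> E2" using u ne[of a] M by (intro within2_arc) auto
  show ?thesis
  proof (cases a)
    case 0
    show ?thesis
    proof (rule that[of "{0, 1, k - 1}"])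
      show "card {0, 1, k - 1} = 3" using k3 by (auto simp: card_insert_if)
      show "(q i, u) \<in> E2" if "i \<in> {0, 1, k - 1}" for i
        using that self via[of 1] via[of "k - 1"] 0 M k3 lassoD(3)[OF q, of 0] lassoD(4)[OF q] arcs_symmetric
        by auto
    qed (use k3 M in auto)
  next
    case (Suc b)
    show ?thesis
    proof (rule that[of "{b, Suc b, Suc (Suc b)}"])
      show "(q i, u) \<in> E2" if "i \<in> {b, Suc b, Suc (Suc b)}" for i
        using that self via[of b] via[of "Suc (Suc b)"] Suc M lassoD(3)[OF q, of b]
          lassoD(3)[OF q, of "Suc b"] arcs_symmetric
        by auto
    qed (use Suc M in auto)
  qed
qed

end

text \<open>An edge between \<open>q i\<close> and \<open>q j\<close> with j > i + 1 closes that
  segment to a cycle. By uniqueness its vertices are those at positions below k, and injectivity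
  forces i = 0 and j = k - 1.\<close>

lemma (in unicyclic_graph) lasso_spanning:
  assumes q: "lasso L q" and L: "L = card (pverts G)"
  shows "is_lasso G L k q"
proof -
  have im: "q ` {..<L} = pverts G"
    using lasso_verts[OF q] L card_image[OF lassoD(2)[OF q]] pair_finite_verts
    by (intro card_subset_eq) auto
  have qc: "q ` {..<k} = c ` {..<k}"
    using lasso_cycle_arc[OF q] lassoD(1,2)[OF q] k3
    by (intro c_unique) (auto intro: inj_on_subset)
  have chord: "i = 0 \<and> Suc j = k" if ij: "i < j" "j < L" "j \<noteq> Suc i" and arc: "(q i, q j) \<in> parcs G" for i j
  proof -
    define l where "l = Suc (j - i)"
    define d where "d m = q (i + m)" for m
    have dj: "d (j - i) = q j" using ij by (simp add: d_def)
    have l3: "l \<ge> 3" using ij by (simp add: l_def)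
    have "d ` {..<l} = c ` {..<k}"
    proof (rule c_unique[OF l3])
      show "inj_on d {..<l}"
        using ij lasso_inj[OF q] by (auto simp: inj_on_def d_def l_def)
      show "(d m, d (Suc m mod l)) \<in> parcs G" if "m < l" for m
      proof (cases "Suc m = l")
        case True
        then have "m = j - i" by (simp add: l_def)
        with True arc dj show ?thesis using arcs_symmetric by (simp add: d_def)
      next
        case False
        then show ?thesis using that ij lassoD(3)[OF q, of "i + m"] by (simp add: d_def l_def)
      qed
    qed
    then have "q ` ((+) i ` {..<l}) = q ` {..<k}"
      unfolding qc[symmetric] d_def[abs_def] image_image by simp
    moreover have "(+) i ` {..<l} = {i..j}"
      using ij by (simp add: lessThan_atLeast0 l_def) auto
    ultimately have "q ` {i..j} = q ` {..<k}" by simp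
    moreover have "{i..j} \<subseteq> {..<L}" "{..<k} \<subseteq> {..<L}" using ij lassoD(1)[OF q] by auto
    ultimately have "{i..j} = {..<k}"
      using inj_on_image_eq_iff[OF lassoD(2)[OF q]] by blast
    moreover have "0 \<in> {..<k}" "k - 1 \<in> {..<k}" "k \<notin> {..<k}" "j \<in> {i..j}" using k3 ij by auto
    ultimately have "i \<le> 0" "k - 1 \<le> j" "j < k" by (metis atLeastAtMost_iff lessThan_iff)+
    then show ?thesis by auto
  qed
  have "(q i, q j) \<in> parcs G \<longleftrightarrow> chord_rel k i j" if "i < L" "j < L" for i j
  proof
    assume arc: "(q i, q j) \<in> parcs G"
    then have "i \<noteq> j" using no_loops' by auto
    then consider "i < j" | "j < i" by linarith
    then show "chord_rel k i j"
      using chord[of i j] chord[of j i] arc arcs_symmetric[OF arc] that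
      by cases (auto simp: chord_rel_def)
  next
    assume "chord_rel k i j"
    then consider "j = Suc i" | "i = Suc j" | "i = 0" "j = k - 1" | "j = 0" "i = k - 1"
      by (auto simp: chord_rel_def)
    then show "(q i, q j) \<in> parcs G"
      using lassoD(3)[OF q] lassoD(4)[OF q] that arcs_symmetric by cases auto
  qed
  note arc_iff = this
  have "parcs G = {(q i, q j) | i j. i < L \<and> j < L \<and> chord_rel k i j}"
  proof (intro equalityI subsetI)
    fix p assume p: "p \<in> parcs G"
    then have "fst p \<in> q ` {..<L}" "snd p \<in> q ` {..<L}"
      unfolding im by (simp_all add: arc_fst_in_verts arc_snd_in_verts)
    then obtain i j where "p = (q i, q j)" "i < L" "j < L" by (cases p) auto
    then show "p \<in> {(q i, q j) | i j. i < L \<and> j < L \<and> chord_rel k i j}" using p arc_iff by blast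
  next
    fix p assume "p \<in> {(q i, q j) | i j. i < L \<and> j < L \<and> chord_rel k i j}"
    then show "p \<in> parcs G" using arc_iff by blast
  qed
  then show ?thesis using im lassoD(2)[OF q] by (simp add: is_lasso_def bij_betw_def)
qed

section \<open>Graphs whose square has radius at least four\<close>

lemma sum_insert_edge:
  fixes f :: "nat \<Rightarrow> real"
  assumes "(a, b) \<notin> lasso_edges n"
  shows "(\<Sum>(i, j)\<in>insert (a, b) (lasso_edges n). f i * f j)
    = (\<Sum>(i, j)\<in>lasso_edges n. f i * f j) + f a * f b"
  using assms by simp

lemma sum_exchange:
  fixes g :: "'b \<Rightarrow> real"
  assumes "finite A" "B \<subseteq> A" "finite C" "C \<inter> A = {}"
  shows "sum g ((A - B) \<union> C) = sum g A - sum g B + sum g C"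
proof -
  have "sum g ((A - B) \<union> C) = sum g (A - B) + sum g C"
    using assms by (intro sum.union_disjoint) auto
  then show ?thesis using assms by (simp add: sum_diff)
qed

context cyclic_graph begin

lemma square_radius_ge_4_long_cycle:
  assumes "k \<ge> 5"
  shows "square_radius \<ge> 4"
proof -
  \<comment> \<open>\<open>D\<close> holds the edges of the squared cycle that wrap around. The pair
    (0, 3) is removed because in general it is no edge of that square; for k = 5 it equals (0, k -
    2) and returns with \<open>D\<close>. The count is (2 k - 2) - 1 + 3 = 2 k.\<close>
  define D :: "(nat \<times> nat) set" where "D = {(0, k - 1), (0, k - 2), (1, k - 1)}"
  let ?F = "(lasso_edges k - {(0, 3)}) \<union> D"
  note q = lasso_c
  have card: "2 * real k \<le> real (card ?F)"
  proof -
    have "card ?F = card (lasso_edges k - {(0, 3)}) + card D"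
      using assms by (intro card_Un_disjoint) (auto simp: D_def lasso_edges_iff)
    moreover have "card D = 3" using assms by (auto simp: D_def card_insert_if)
    moreover have "(0, 3) \<in> lasso_edges k" using assms by (simp add: lasso_edges_def)
    then have "real (card (lasso_edges k - {(0, 3)})) = real (card (lasso_edges k)) - 1"
      using card_Suc_Diff1[OF finite_lasso_edges, of "(0, 3)" k] by linarith
    ultimately show ?thesis using card_lasso_edges[of k] assms by simp
  qed
  have 1: "(c 0, c (k - 1)) \<in> parcs G" by (rule lassoD(4)[OF q])
  have 2: "(c (k - 1), c (k - 2)) \<in> parcs G"
  proof -
    have "Suc (k - 2) = k - 1" "Suc (k - 2) < k" using assms by auto
    then show ?thesis using arcs_symmetric[OF lassoD(3)[OF q, of "k - 2"]] by simp
  qed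
  have 3: "(c 1, c 0) \<in> parcs G" using arcs_symmetric[OF lassoD(3)[OF q, of 0]] assms by simp
  have ne: "c 0 \<noteq> c (k - 1)" "c 0 \<noteq> c (k - 2)" "c 1 \<noteq> c (k - 1)"
    using lasso_inj[OF q, of 0 "k - 1"] lasso_inj[OF q, of 0 "k - 2"] lasso_inj[OF q, of 1 "k - 1"] assms
    by auto
  note * = within2_arc[OF 1 ne(1)] within2_common[OF 1 2 ne(2)] within2_common[OF 3 1 ne(3)]
  show ?thesis
  proof (rule square_radius_ge_4_ones[OF c_inj lasso_verts[OF q] _ _ _ card])
    show "?F \<subseteq> {(i, j). i < j \<and> j < k}" using assms by (auto simp: D_def lasso_edges_def)
    show "(c i, c j) \<in> E2" if "(i, j) \<in> ?F" for i j
      using that * lasso_square_near[OF q, of i j] by (auto simp: D_def lasso_edges_def)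
  qed (use k3 in simp)
qed

lemma lasso_append_inj:
  assumes "lasso L q" "u \<notin> q ` {..<L}" "u' \<notin> q ` {..<L}" "u \<noteq> u'"
  shows "inj_on (q(L := u, Suc L := u')) {..<L + 2}"
  using assms by (auto simp: lasso_def inj_on_def less_Suc_eq)

text \<open>Each attached vertex brings three edges: (2 L - 2) + 3 + 3 = 2 (L + 2).\<close>

lemma square_radius_ge_4_two_attached:
  assumes q: "lasso L q" "L \<ge> 4" "k = 3"
    and u: "u \<notin> q ` {..<L}" "(q a, u) \<in> parcs G" "Suc a < L"
    and u': "u' \<notin> q ` {..<L}" "(q b, u') \<in> parcs G" "Suc b < L" and uu': "u \<noteq> u'"
  shows "square_radius \<ge> 4"
proof -
  obtain K where K: "K \<subseteq> {..<L}" "card K = 3" "\<And>i. i \<in> K \<Longrightarrow> (q i, u) \<in> E2"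
    using attached_vertex[OF q(1) u(1,2), of L] u q by auto
  obtain K' where K': "K' \<subseteq> {..<L}" "card K' = 3" "\<And>i. i \<in> K' \<Longrightarrow> (q i, u') \<in> E2"
    using attached_vertex[OF q(1) u'(1,2), of L] u' q by auto
  have fin: "finite K" "finite K'" using K K' finite_subset by blast+
  let ?r = "q(L := u, Suc L := u')"
  let ?F = "lasso_edges L \<union> K \<times> {L} \<union> K' \<times> {Suc L}"
  show ?thesis
  proof (rule square_radius_ge_4_ones[of ?r "L + 2" ?F])
    show "inj_on ?r {..<L + 2}" using q u u' uu' by (intro lasso_append_inj)
    show "?r ` {..<L + 2} \<subseteq> pverts G"
      using lasso_verts[OF q(1)] in_arcsD2[OF u(2)] in_arcsD2[OF u'(2)] by (auto simp: less_Suc_eq)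
    show "?F \<subseteq> {(i, j). i < j \<and> j < L + 2}" using K K' by (auto simp: lasso_edges_def)
    show "(?r i, ?r j) \<in> E2" if ij: "(i, j) \<in> ?F" for i j
    proof -
      consider "(i, j) \<in> lasso_edges L" | "i \<in> K" "j = L" | "i \<in> K'" "j = Suc L" using ij by auto
      then show ?thesis
      proof cases
        case 1
        then have "i < L" "j < L" by (auto simp: lasso_edges_def)
        then show ?thesis using lasso_edges_square[OF q(1) _ 1] q(3) by simp
      qed (use K K' in auto)
    qed
    have "card ?F = card (lasso_edges L) + card (K \<times> {L}) + card (K' \<times> {Suc L})"
      using fin by (subst card_Un_disjoint; (subst card_Un_disjoint)?) (auto simp: lasso_edges_iff)
    then show "real (card ?F) \<ge> 2 * real (L + 2)"
      using card_lasso_edges[OF q(2)] K K' by (simp add: card_cartesian_product)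
  qed simp
qed

text \<open>The 4-cycle gives the extra edge {0, 4} through \<open>q 3\<close>, and \<open>u\<close>
  brings three more: (2 L - 2) + 1 + 3 = 2 (L + 1).\<close>

lemma square_radius_ge_4_attached_4:
  assumes q: "lasso L q" "L \<ge> 5" "k = 4"
    and u: "u \<notin> q ` {..<L}" "(q a, u) \<in> parcs G" "Suc a < L"
  shows "square_radius \<ge> 4"
proof -
  obtain K where K: "K \<subseteq> {..<L}" "card K = 3" "\<And>i. i \<in> K \<Longrightarrow> (q i, u) \<in> E2"
    using attached_vertex[OF q(1) u(1,2), of L] u q by auto
  have fin: "finite K" using K finite_subset by blast
  let ?r = "q(L := u)"
  let ?F = "(lasso_edges L \<union> {(0, 4)}) \<union> K \<times> {L}"
  show ?thesis
  proof (rule square_radius_ge_4_ones[of ?r "L + 1" ?F])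
    show "inj_on ?r {..<L + 1}" using q(1) u by (auto simp: lasso_def inj_on_def less_Suc_eq)
    show "?r ` {..<L + 1} \<subseteq> pverts G"
      using lasso_verts[OF q(1)] in_arcsD2[OF u(2)] by (auto simp: less_Suc_eq)
    show "?F \<subseteq> {(i, j). i < j \<and> j < L + 1}" using K q by (auto simp: lasso_edges_def)
    show "(?r i, ?r j) \<in> E2" if ij: "(i, j) \<in> ?F" for i j
    proof -
      consider "(i, j) \<in> lasso_edges L" | "i = 0" "j = 4" | "i \<in> K" "j = L" using ij by auto
      then show ?thesis
      proof cases
        case 1
        then have "i < L" "j < L" by (auto simp: lasso_edges_def)
        then show ?thesis using lasso_edges_square[OF q(1) _ 1] q(3) by simp
      next
        case 2
        then show ?thesis using lasso_square_chord[OF q(1)] q by simp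
      qed (use K in auto)
    qed
    have "card ?F = card (lasso_edges L \<union> {(0, 4)}) + card (K \<times> {L})"
      using fin q by (intro card_Un_disjoint) (auto simp: lasso_edges_iff)
    moreover have "card (lasso_edges L \<union> {(0, 4)}) = Suc (card (lasso_edges L))"
      by (simp add: lasso_edges_iff)
    ultimately show "real (card ?F) \<ge> 2 * real (L + 1)"
      using card_lasso_edges[of L] q K by (simp add: card_cartesian_product)
  qed simp
qed

text \<open>All-ones weights fall one edge short here, with 2 L + 3 edges on L + 2 vertices. Halving
  both ends repairs this: each end has two edges in the count, which lose half their weight, while
  its square drops to 1/4.\<close>

lemma square_radius_ge_4_attached_path:
  assumes q: "lasso L q" "L \<ge> 5" "k = 3"
    and u: "u \<notin> q ` {..<L}" "(q a, u) \<in> parcs G" "a + 2 < L"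
    and u': "u' \<notin> q ` {..<L}" "(u, u') \<in> parcs G"
  shows "square_radius \<ge> 4"
proof -
  have uu': "u \<noteq> u'" using u' no_loops' by auto
  obtain K where K: "K \<subseteq> {..<L - 1}" "card K = 3" "\<And>i. i \<in> K \<Longrightarrow> (q i, u) \<in> E2"
    by (rule attached_vertex[OF q(1) u(1,2), of "L - 1"]) (use u q in auto)
  have fin: "finite K" using K finite_subset by blast
  let ?r = "q(L := u, Suc L := u')"
  let ?A = "{(L, Suc L), (a, Suc L)}"
  let ?F = "lasso_edges L \<union> K \<times> {L} \<union> ?A"
  \<comment> \<open>The full-weight lasso edges, the two edges at L - 1, \<open>K\<close> and the
    two edges of \<open>u'\<close> add up to (2 L - 4) + 1 + 3 + 1 = 2 L + 1, and the squared norm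
    is L + 1/2. For this, \<open>a\<close> and \<open>K\<close> must avoid L - 1, which a + 2 < L
    ensures.\<close>
  define f :: "nat \<Rightarrow> real" where "f i = (if i = L - 1 \<or> i = Suc L then 1 / 2 else 1)" for i
  define S where "S = (\<Sum>(i, j)\<in>?F. f i * f j)"
  have "2 * S \<le> square_radius * (\<Sum>i<L + 2. (f i)\<^sup>2)"
    unfolding S_def
  proof (rule square_radius_lower[where r = ?r])
    show "inj_on ?r {..<L + 2}" using q u u' uu' by (intro lasso_append_inj)
    show "?r ` {..<L + 2} \<subseteq> pverts G"
      using lasso_verts[OF q(1)] in_arcsD2[OF u(2)] in_arcsD2[OF u'(2)] by (auto simp: less_Suc_eq)
    show "?F \<subseteq> {(i, j). i < j \<and> j < L + 2}" using K u by (auto simp: lasso_edges_def)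
    show "(?r i, ?r j) \<in> E2" if ij: "(i, j) \<in> ?F" for i j
    proof -
      consider "(i, j) \<in> lasso_edges L" | "i \<in> K" "j = L" | "i = L" "j = Suc L" | "i = a" "j = Suc L"
        using ij by auto
      then show ?thesis
      proof cases
        case 1
        then have "i < L" "j < L" by (auto simp: lasso_edges_def)
        then show ?thesis using lasso_edges_square[OF q(1) _ 1] q(3) by simp
      next
        case 2
        then have "i < L" using K by auto
        then show ?thesis using 2 K by auto
      next
        case 3
        then show ?thesis using u' uu' by (auto intro: within2_arc)
      next
        case 4
        then have "q a \<noteq> u'" using u u' by auto
        then show ?thesis using 4 u u' by (auto intro: within2_common)
      qed
    qed
  qed (simp add: f_def)
  moreover have "S = 2 * real L + 1"
  proof -
    have "S = (\<Sum>(i, j)\<in>lasso_edges L. f i * f j) + (\<Sum>(i, j)\<in>K \<times> {L}. f i * f j) + (\<Sum>(i, j)\<in>?A. f i * f j)"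
      unfolding S_def using fin K u
      by (subst sum.union_disjoint; (subst sum.union_disjoint)?) (auto simp: lasso_edges_iff)
    moreover have "(\<Sum>(i, j)\<in>K \<times> {L}. f i * f j) = (\<Sum>p\<in>K \<times> {L}. 1)"
    proof (intro sum.cong refl)
      fix p assume "p \<in> K \<times> {L}"
      then have "fst p < L - 1" "snd p = L" using K(1) by auto
      then show "(case p of (i, j) \<Rightarrow> f i * f j) = 1" by (cases p) (auto simp: f_def)
    qed
    moreover have "(\<Sum>(i, j)\<in>?A. f i * f j) = 1"
    proof -
      have "a \<noteq> L - 1" "L \<noteq> L - 1" "a \<noteq> L" "a \<noteq> Suc L" using u by auto
      then show ?thesis by (simp add: f_def)
    qed
    moreover have "(\<Sum>(i, j)\<in>lasso_edges L. f i * f j) = 2 * real L - 3"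
    proof -
      obtain M where M: "L = Suc M" "M \<ge> 4" using q by (cases L) auto
      have "(\<Sum>(i, j)\<in>lasso_edges M. f i * f j) = (\<Sum>p\<in>lasso_edges M. 1)"
        using M by (intro sum.cong) (auto simp: f_def lasso_edges_def)
      moreover have "f M = 1 / 2" "f (M - 1) = 1" "f (M - 2) = 1" using M by (auto simp: f_def)
      ultimately show ?thesis
        unfolding M(1) sum_lasso_edges_Suc[OF M(2)] using card_lasso_edges[OF M(2)] by simp
    qed
    ultimately show ?thesis using K by (simp add: card_cartesian_product)
  qed
  moreover have "(\<Sum>i<L + 2. (f i)\<^sup>2) = real L + 1 / 2"
  proof -
    obtain M where M: "L = Suc M" using q by (cases L) auto
    have "(\<Sum>i<M. (f i)\<^sup>2) = (\<Sum>i<M. 1)" using M by (intro sum.cong) (auto simp: f_def)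
    then show ?thesis using M by (simp add: f_def power2_eq_square)
  qed
  ultimately have "4 * (real L + 1 / 2) \<le> square_radius * (real L + 1 / 2)" by simp
  then show ?thesis by (rule mult_right_le_imp_le) simp
qed

end

section \<open>Comparison with the Perron vector\<close>

context cyclic_graph begin

text \<open>Reduces a comparison with the squared \<open>W\<close> to two edge sums:
  \<open>f\<close> is the Perron vector belonging to \<open>\<rho>\<close>, and the listing
  \<open>r\<close> places its entries on the competitor.\<close>

lemma square_radius_greater:
  fixes f :: "nat \<Rightarrow> real"
  assumes "inj_on r {..<n}" "r ` {..<n} \<subseteq> pverts G" "n > 0"
    and F: "F \<subseteq> {(i, j). i < j \<and> j < n}" "\<And>i j. (i, j) \<in> F \<Longrightarrow> (r i, r j) \<in> E2"
    and f: "\<And>i. i < n \<Longrightarrow> 0 < f i" "2 * (\<Sum>(i, j)\<in>lasso_edges n. f i * f j) = \<rho> * (\<Sum>i<n. (f i)\<^sup>2)"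
    and less: "(\<Sum>(i, j)\<in>lasso_edges n. f i * f j) < (\<Sum>(i, j)\<in>F. f i * f j)"
  shows "\<rho> < square_radius"
proof -
  have "2 * (\<Sum>(i, j)\<in>F. f i * f j) \<le> square_radius * (\<Sum>i<n. (f i)\<^sup>2)"
    using f(1) by (intro square_radius_lower[OF assms(1,2) _ F]) (auto intro: less_imp_le)
  then have "\<rho> * (\<Sum>i<n. (f i)\<^sup>2) < square_radius * (\<Sum>i<n. (f i)\<^sup>2)"
    using f(2) less by linarith
  moreover have "(\<Sum>i<n. (f i)\<^sup>2) \<ge> 0" by (simp add: sum_nonneg)
  ultimately show ?thesis by (meson mult_right_mono not_le)
qed

lemma spanning_4_lasso_greater:
  assumes H: "squared_lasso H n s" "n \<ge> 5" and q: "lasso n q" "k = 4"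
  shows "graph_spectral_radius H < square_radius"
proof (rule squared_lasso.perron_vector[OF H(1)])
  fix f assume f: "\<And>i. i < n \<Longrightarrow> 0 < f i"
    "2 * (\<Sum>(i, j)\<in>lasso_edges n. f i * f j) = graph_spectral_radius H * (\<Sum>i<n. (f i)\<^sup>2)"
  show ?thesis
  proof (rule square_radius_greater[where F = "insert (0, 4) (lasso_edges n)", OF _ _ _ _ _ f])
    show "inj_on q {..<n}" "q ` {..<n} \<subseteq> pverts G" using lassoD(2)[OF q(1)] lasso_verts[OF q(1)] .
    show "(\<Sum>(i, j)\<in>lasso_edges n. f i * f j) < (\<Sum>(i, j)\<in>insert (0, 4) (lasso_edges n). f i * f j)"
      using f(1) H(2) by (subst sum_insert_edge) (auto simp: lasso_edges_iff)
    show "(q i, q j) \<in> E2" if "(i, j) \<in> insert (0, 4) (lasso_edges n)" for i j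
      using that lasso_edges_square[OF q(1), of i j] lasso_square_chord[OF q(1)] q(2) H(2) by auto
  qed (use H(2) in \<open>auto simp: lasso_edges_iff\<close>)
qed

definition insert_at :: "nat \<Rightarrow> 'a \<Rightarrow> (nat \<Rightarrow> 'a) \<Rightarrow> nat \<Rightarrow> 'a" where
  "insert_at p u q i = (if i < p then q i else if i = p then u else q (i - 1))"

lemma insert_at_lasso:
  assumes q: "lasso L q" and u: "u \<notin> q ` {..<L}" "u \<in> pverts G" and p: "p \<le> L"
  shows "inj_on (insert_at p u q) {..<Suc L}" "insert_at p u q ` {..<Suc L} \<subseteq> pverts G"
proof -
  let ?g = "\<lambda>i. if i < p then i else i - 1"
  have r: "insert_at p u q i = q (?g i)" if "i \<noteq> p" for i
    using that by (simp add: insert_at_def)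
  have g: "?g i < L" if "i \<noteq> p" "i < Suc L" for i using that p by auto
  have ne: "q (?g i) \<noteq> u" if "i \<noteq> p" "i < Suc L" for i
    using g[OF that] u(1) by blast
  have p': "insert_at p u q p = u" by (simp add: insert_at_def)
  show "inj_on (insert_at p u q) {..<Suc L}"
  proof (rule inj_onI)
    fix i j assume ij: "i \<in> {..<Suc L}" "j \<in> {..<Suc L}" "insert_at p u q i = insert_at p u q j"
    show "i = j"
    proof (cases "i = p \<or> j = p")
      case True
      then show ?thesis using ij ne[of i] ne[of j] r[of i] r[of j] p' by (metis lessThan_iff)
    next
      case False
      then have "?g i = ?g j" using ij r[of i] r[of j] lasso_inj[OF q g[of i] g[of j]] by simp
      then show ?thesis using False by (auto split: if_splits)
    qed
  qed
  show "insert_at p u q ` {..<Suc L} \<subseteq> pverts G"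
  proof
    fix x assume "x \<in> insert_at p u q ` {..<Suc L}"
    then obtain i where i: "i < Suc L" "x = insert_at p u q i" by auto
    show "x \<in> pverts G"
    proof (cases "i = p")
      case True
      then show ?thesis using i p' u by simp
    next
      case False
      then show ?thesis using i r[OF False] g[OF False i(1)] lasso_verts[OF q] by auto
    qed
  qed
qed

text \<open>With \<open>u\<close> in front, the triangle moves to positions 1, 2, 3, all within
  distance two of \<open>u\<close>. No edge is lost, and {1, 4} is gained, namely \<open>q 0\<close>
  and \<open>q 3\<close>, joined through \<open>q 2\<close>.\<close>

lemma attached_near_triangle_greater:
  assumes H: "squared_lasso H n s" "n \<ge> 5" and q: "lasso L q" "k = 3" "n = Suc L"
    and u: "u \<notin> q ` {..<L}" "(q a, u) \<in> parcs G" "a < 3"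
  shows "graph_spectral_radius H < square_radius"
proof (rule squared_lasso.perron_vector[OF H(1)])
  fix f assume f: "\<And>i. i < n \<Longrightarrow> 0 < f i"
    "2 * (\<Sum>(i, j)\<in>lasso_edges n. f i * f j) = graph_spectral_radius H * (\<Sum>i<n. (f i)\<^sup>2)"
  have ua: "(u, q a) \<in> parcs G" by (rule arcs_symmetric[OF u(2)])
  have near: "(u, q i) \<in> E2" if i: "i < 3" for i
  proof -
    have ne: "u \<noteq> q i" using u(1) i H(2) q(3) by auto
    show ?thesis
    proof (cases "i = a")
      case True
      then show ?thesis using within2_arc[OF ua] ne by simp
    next
      case False
      have tri: "(q 0, q 1) \<in> parcs G" "(q 1, q 2) \<in> parcs G" "(q 0, q 2) \<in> parcs G"
        using lassoD(3)[OF q(1), of 0] lassoD(3)[OF q(1), of 1] lassoD(4)[OF q(1)] q H(2)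
        by (auto simp: numeral_2_eq_2)
      have "a = 0 \<or> a = 1 \<or> a = 2" "i = 0 \<or> i = 1 \<or> i = 2" using u(3) i by auto
      then have "(q a, q i) \<in> parcs G" using False tri tri[THEN arcs_symmetric] by auto
      then show ?thesis using within2_common[OF ua _ ne] by simp
    qed
  qed
  define r where "r = insert_at 0 u q"
  have r0: "r 0 = u" and rS: "r (Suc i) = q i" for i by (simp_all add: r_def insert_at_def)
  show ?thesis
  proof (rule square_radius_greater[where F = "insert (1, 4) (lasso_edges n)", OF _ _ _ _ _ f])
    show "inj_on r {..<n}" "r ` {..<n} \<subseteq> pverts G"
      unfolding r_def q(3) using insert_at_lasso[OF q(1) u(1) in_arcsD2[OF u(2)]] by simp_all
    show "(\<Sum>(i, j)\<in>lasso_edges n. f i * f j) < (\<Sum>(i, j)\<in>insert (1, 4) (lasso_edges n). f i * f j)"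
      using f(1) H(2) by (subst sum_insert_edge) (auto simp: lasso_edges_iff)
    show "(r i, r j) \<in> E2" if ij: "(i, j) \<in> insert (1, 4) (lasso_edges n)" for i j
    proof (cases "(i, j) = (1, 4)")
      case True
      then show ?thesis using lasso_square_chord[OF q(1)] q H(2) by (simp add: rS numeral_eq_Suc)
    next
      case False
      then have e: "i < j" "j < n" "j \<le> i + 2 \<or> i = 0 \<and> j = 3" using ij by (auto simp: lasso_edges_iff)
      then obtain j' where j': "j = Suc j'" by (cases j) auto
      show ?thesis
      proof (cases i)
        case 0
        then show ?thesis using near[of j'] e j' by (auto simp: r0 rS)
      next
        case (Suc i')
        then show ?thesis using lasso_square_near[OF q(1), of i' j'] e j' q(3) by (auto simp: rS)
      qed
    qed
  qed (use H(2) in \<open>auto simp: lasso_edges_iff\<close>)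
qed

text \<open>The attached vertex \<open>u\<close> and its neighbour \<open>q a\<close> take the positions \<open>a\<close> and \<open>a + 1\<close> of the Perron
  vector of the squared lasso; if \<open>q a\<close> receives the larger of the two entries, every edge that is lost
  is outweighed by one that is gained.\<close>

lemma attached_far_greater:
  assumes H: "squared_lasso H n s" and q: "lasso L q" "k = 3" "n = Suc L"
    and u: "u \<notin> q ` {..<L}" "(q a, u) \<in> parcs G" "3 \<le> a" "Suc a < L"
  shows "graph_spectral_radius H < square_radius"
proof (rule squared_lasso.perron_vector[OF H(1)])
  fix f assume f: "\<And>i. i < n \<Longrightarrow> 0 < f i"
    "2 * (\<Sum>(i, j)\<in>lasso_edges n. f i * f j) = graph_spectral_radius H * (\<Sum>i<n. (f i)\<^sup>2)"
  have n0: "n > 0" using q by simp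
  have ne: "q i \<noteq> u" if "i < L" for i using u(1) that by auto
  have ua: "(q a, u) \<in> E2" using u ne[of a] by (intro within2_arc) auto
  have u1: "(q (a - 1), u) \<in> E2"
    using lassoD(3)[OF q(1), of "a - 1"] u ne[of "a - 1"] by (intro within2_common[of _ "q a"]) auto
  have u2: "(q (Suc a), u) \<in> E2"
    using lassoD(3)[OF q(1), of a] u ne[of "Suc a"]
    by (intro within2_common[OF arcs_symmetric u(2)]) auto
  have near: "(q i, q j) \<in> E2" if "i < j" "j < L" "j \<le> i + 2" for i j
    by (rule lasso_square_near[OF q(1) that])
  have chord: "(q 0, q 3) \<in> E2" using lasso_square_chord[OF q(1)] q u by simp
  let ?S = "\<lambda>F. \<Sum>(i, j)\<in>F. f i * f j"
  show ?thesis
  proof (cases "f (Suc a) \<le> f a")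
    case True
    define r where "r i = (if i \<le> a then q i else if i = Suc a then u else q (i - 1))" for i
    have r_eq: "r = insert_at (Suc a) u q" by (auto simp: r_def insert_at_def)
    \<comment> \<open>Position a + 1 holds \<open>u\<close>, whose pair with
      \<open>q (a + 2)\<close> at position a + 3 is given up if that position exists. The pair of
      \<open>q a\<close> with \<open>q (a + 2)\<close> replaces it, and \<open>q (a - 1)\<close>
      with \<open>q (a + 1)\<close> is a pure gain.\<close>
    define B where "B = {(Suc a, a + 3)} \<inter> lasso_edges n"
    define C where "C = {(a - 1, a + 2)} \<union> (if a + 3 < n then {(a, a + 3)} else {})"
    show ?thesis
    proof (rule square_radius_greater[OF _ _ n0 _ _ f, of r "(lasso_edges n - B) \<union> C"])
      show "inj_on r {..<n}" "r ` {..<n} \<subseteq> pverts G"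
        unfolding r_eq q(3) using insert_at_lasso[OF q(1) u(1) in_arcsD2[OF u(2)]] u(4) by simp_all
      show "(lasso_edges n - B) \<union> C \<subseteq> {(i, j). i < j \<and> j < n}"
        using u q by (auto simp: C_def lasso_edges_iff split: if_splits)
      have short: "(r i, r j) \<in> E2" if ij: "i < j" "j < n" "j \<le> i + 2" "(i, j) \<noteq> (Suc a, a + 3)" for i j
      proof -
        consider "j \<le> a" | "i < a" "a < j" | "i = a" | "i = Suc a" | "Suc a < i"
          using ij(1) by linarith
        then show ?thesis
        proof cases
          case 1
          then show ?thesis using near[of i j] ij u by (simp add: r_def)
        next
          case 2
          then have "i = a - 1" "j = Suc a" using ij by auto
          then show ?thesis using u1 by (simp add: r_def)
        next
          case 3
          then have "j = Suc a \<or> j = a + 2" using ij by auto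
          then show ?thesis using 3 ua near[of a "Suc a"] u by (auto simp: r_def)
        next
          case 4
          then have "j = a + 2" using ij by auto
          then show ?thesis using 4 sym_E2[OF u2] by (simp add: r_def)
        next
          case 5
          then show ?thesis using near[of "i - 1" "j - 1"] ij q(3) by (simp add: r_def)
        qed
      qed
      show "(r i, r j) \<in> E2" if ij: "(i, j) \<in> (lasso_edges n - B) \<union> C" for i j
      proof -
        consider "i = a - 1" "j = a + 2" | "i = a" "j = a + 3" "a + 3 < n" | "i = 0" "j = 3"
          | "i < j" "j < n" "j \<le> i + 2" "(i, j) \<noteq> (Suc a, a + 3)"
          using ij unfolding B_def C_def by (auto simp: lasso_edges_iff split: if_splits)
        then show ?thesis
        proof cases
          case 1
          then show ?thesis using near[of "a - 1" "Suc a"] u by (simp add: r_def)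
        next
          case 2
          then show ?thesis using near[of a "a + 2"] q(3) by (simp add: r_def)
        next
          case 3
          then show ?thesis using chord u by (simp add: r_def)
        qed (rule short)
      qed
      have "?S ((lasso_edges n - B) \<union> C) = ?S (lasso_edges n) - ?S B + ?S C"
        using u by (intro sum_exchange) (auto simp: B_def C_def lasso_edges_iff split: if_splits)
      moreover have "?S B < ?S C"
      proof (cases "a + 3 < n")
        case True
        have "f (Suc a) * f (a + 3) \<le> f a * f (a + 3)"
          using \<open>f (Suc a) \<le> f a\<close> f(1)[of "a + 3"] True by (intro mult_right_mono) auto
        moreover have "0 < f (a - 1) * f (a + 2)" using f(1) True by simp
        moreover have "B = {(Suc a, a + 3)}" using True by (auto simp: B_def lasso_edges_iff)
        moreover have "?S C = f (a - 1) * f (a + 2) + f a * f (a + 3)" using True by (simp add: C_def)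
        ultimately show ?thesis by simp
      next
        case False
        have "0 < f (a - 1) * f (a + 2)" using f(1) u q by simp
        moreover have "B = {}" using False by (auto simp: B_def lasso_edges_iff)
        ultimately show ?thesis using False by (simp add: C_def)
      qed
      ultimately show "?S (lasso_edges n) < ?S ((lasso_edges n - B) \<union> C)" by simp
    qed
  next
    case False
    then have le: "f a \<le> f (Suc a)" by simp
    define r where "r i = (if i < a then q i else if i = a then u else q (i - 1))" for i
    have r_eq: "r = insert_at a u q" by (auto simp: r_def insert_at_def)
    \<comment> \<open>\<open>u\<close> now holds position a, and its pairs with the positions in
      \<open>D\<close> are given up: a - 2, and for a = 3 also 0 because of the edge {0, 3}. The
      same positions are adjacent to \<open>q a\<close> at a + 1, where the Perron entry is at least
      as large; (a - 1, a + 2) is a pure gain.\<close>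
    define D where "D = (if a = 3 then {0, 1} else {a - 2})"
    define B where "B = (\<lambda>i. (i, a)) ` D"
    define C where "C = insert (a - 1, a + 2) ((\<lambda>i. (i, Suc a)) ` D)"
    have D: "finite D" "\<And>i. i \<in> D \<Longrightarrow> i \<le> a - 2"
      using u by (auto simp: D_def split: if_splits)
    show ?thesis
    proof (rule square_radius_greater[OF _ _ n0 _ _ f, of r "(lasso_edges n - B) \<union> C"])
      show "inj_on r {..<n}" "r ` {..<n} \<subseteq> pverts G"
        unfolding r_eq q(3) using insert_at_lasso[OF q(1) u(1) in_arcsD2[OF u(2)]] u(4) by simp_all
      show "(lasso_edges n - B) \<union> C \<subseteq> {(i, j). i < j \<and> j < n}"
        using u q by (auto simp: C_def D_def lasso_edges_iff split: if_splits)
      have short: "(r i, r j) \<in> E2" if ij: "i < j" "j < n" "j \<le> i + 2" "(i, j) \<noteq> (a - 2, a)" for i j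
      proof -
        consider "j < a" | "j = a" | "i < a" "a < j" | "i = a" | "a < i"
          using ij(1) by linarith
        then show ?thesis
        proof cases
          case 1
          then show ?thesis using near[of i j] ij u by (simp add: r_def)
        next
          case 2
          then have "i = a - 1" using ij by auto
          then show ?thesis using 2 u1 u by (simp add: r_def)
        next
          case 3
          then have "i = a - 1" "j = Suc a" using ij by auto
          then show ?thesis using near[of "a - 1" a] u by (simp add: r_def)
        next
          case 4
          then have "j = Suc a \<or> j = a + 2" using ij by auto
          then show ?thesis using 4 sym_E2[OF ua] sym_E2[OF u2] by (auto simp: r_def)
        next
          case 5
          then show ?thesis using near[of "i - 1" "j - 1"] ij q(3) by (simp add: r_def)
        qed
      qed
      show "(r i, r j) \<in> E2" if ij: "(i, j) \<in> (lasso_edges n - B) \<union> C" for i j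
      proof -
        consider "i = a - 1" "j = a + 2" | "i = a - 2" "j = Suc a" | "i = 0" "j = 4" "a = 3"
          | "i = 0" "j = 3" "a \<noteq> 3" | "i < j" "j < n" "j \<le> i + 2" "(i, j) \<noteq> (a - 2, a)"
          using ij unfolding B_def C_def D_def by (auto simp: lasso_edges_iff split: if_splits)
        then show ?thesis
        proof cases
          case 1
          then show ?thesis using near[of "a - 1" "Suc a"] u by (simp add: r_def)
        next
          case 2
          then show ?thesis using near[of "a - 2" a] u by (simp add: r_def)
        next
          case 3
          then show ?thesis using chord by (simp add: r_def)
        next
          case 4
          then show ?thesis using chord u by (simp add: r_def)
        qed (rule short)
      qed
      have "?S ((lasso_edges n - B) \<union> C) = ?S (lasso_edges n) - ?S B + ?S C"
        using u q by (intro sum_exchange) (auto simp: B_def C_def D_def lasso_edges_iff split: if_splits)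
      moreover have "?S B < ?S C"
      proof -
        have "?S B = (\<Sum>i\<in>D. f i * f a)"
          unfolding B_def by (subst sum.reindex) (auto simp: inj_on_def)
        also have "\<dots> \<le> (\<Sum>i\<in>D. f i * f (Suc a))"
        proof (intro sum_mono mult_left_mono le)
          fix i assume "i \<in> D"
          then have "i < n" using D(2)[of i] u q by simp
          then show "0 \<le> f i" using f(1)[of i] by simp
        qed
        also have "\<dots> = ?S ((\<lambda>i. (i, Suc a)) ` D)"
          by (subst sum.reindex) (auto simp: inj_on_def)
        also have "\<dots> < f (a - 1) * f (a + 2) + ?S ((\<lambda>i. (i, Suc a)) ` D)" using f(1) u q by simp
        also have "\<dots> = ?S C"
          unfolding C_def using D(1) by (subst sum.insert) auto
        finally show ?thesis .
      qed
      ultimately show "?S (lasso_edges n) < ?S ((lasso_edges n - B) \<union> C)" by simp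
    qed
  qed
qed

end

section \<open>Extremality of the triangle with a pendant path\<close>

text \<open>The Perron vector of one graph is a test vector on the other, entry by entry along the
  listings. Applied both ways this takes the place of invariance of the radius under
  isomorphism.\<close>

lemma squared_lasso_radius_le:
  assumes "squared_lasso H n r" "squared_lasso H' n r'"
  shows "graph_spectral_radius H \<le> graph_spectral_radius H'"
proof (rule squared_lasso.perron_vector[OF assms(1)])
  interpret H': squared_lasso H' n r' by fact
  fix f assume f: "\<And>i. i < n \<Longrightarrow> 0 < f i"
    "2 * (\<Sum>(i, j)\<in>lasso_edges n. f i * f j) = graph_spectral_radius H * (\<Sum>i<n. (f i)\<^sup>2)"
  have "graph_spectral_radius H * (\<Sum>i<n. (f i)\<^sup>2) \<le> graph_spectral_radius H' * (\<Sum>i<n. (f i)\<^sup>2)"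
    unfolding f(2)[symmetric]
  proof (rule graph_spectral_radius_lower)
    show "finite (pverts H')" "inj_on r' {..<n}" "r' ` {..<n} \<subseteq> pverts H'"
      using H'.bij bij_betw_finite by (auto simp: bij_betw_def)
    show "(r' i, r' j) \<in> parcs H'" if "(i, j) \<in> lasso_edges n" for i j
      using that H'.arcs[of i j] by (auto simp: lasso_edges_iff)
  qed (use H'.sym f(1) in \<open>auto simp: lasso_edges_iff less_imp_le\<close>)
  moreover have "(\<Sum>i<n. (f i)\<^sup>2) > 0"
  proof (rule sum_pos)
    show "0 < (f i)\<^sup>2" if "i \<in> {..<n}" for i using f(1)[of i] that by simp
  qed (use H'.n4 in \<open>auto simp: lessThan_empty_iff\<close>)
  ultimately show ?thesis by simp
qed

lemma squared_lasso_radius_eq: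
  "squared_lasso H n r \<Longrightarrow> squared_lasso H' n r' \<Longrightarrow> graph_spectral_radius H = graph_spectral_radius H'"
  using squared_lasso_radius_le by (metis antisym)

text \<open>On four indices the lasso pattern contains all six pairs, so it describes the complete
  graph, which is also the square of the 4-cycle.\<close>

lemma squared_lasso_square_4_cycle:
  assumes l: "is_lasso G 4 4 r"
  shows "squared_lasso (graph_square G) 4 r"
proof -
  interpret G: pair_graph G by (rule pair_graph_lasso[OF l]) simp
  have br: "bij_betw r {..<4} (pverts G)" using l by (simp add: is_lasso_def)
  have "(r i, r j) \<in> within2 (parcs G)" if ij: "i < 4" "j < 4" "i \<noteq> j" for i j
  proof -
    have ne: "r i \<noteq> r j" using br ij by (auto simp: bij_betw_def inj_on_def)
    have "chord_rel 4 i j \<or> chord_rel 4 i (Suc i mod 4) \<and> chord_rel 4 (Suc i mod 4) j"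
    proof -
      have "i = 0 \<or> i = 1 \<or> i = 2 \<or> i = 3" "j = 0 \<or> j = 1 \<or> j = 2 \<or> j = 3" using ij by auto
      then show ?thesis using ij(3) by (auto simp: chord_rel_def)
    qed
    then show ?thesis
      using ij ne is_lasso_arc_iff[OF l, of i j] is_lasso_arc_iff[OF l, of i "Suc i mod 4"]
        is_lasso_arc_iff[OF l, of "Suc i mod 4" j]
      by (auto simp: within2_def)
  qed
  moreover have "(r i, r i) \<notin> within2 (parcs G)" for i by (simp add: within2_def)
  moreover have "(i, j) \<in> lasso_edges 4 \<or> (j, i) \<in> lasso_edges 4 \<longleftrightarrow> i \<noteq> j" if "i < 4" "j < 4" for i j
    using that by (auto simp: lasso_edges_iff)
  ultimately show ?thesis
    using br by unfold_locales
      (auto simp: G.pverts_graph_square G.parcs_graph_square sym_within2 G.sym_parcs)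
qed

section \<open>Consequences of the maximal length of a lasso\<close>

context cyclic_graph begin

text \<open>A vertex of the cycle is made last by rotation, which discards the tail; a vertex of the
  tail by truncation.\<close>

lemma lasso_ending_at:
  assumes q: "lasso L q" and a: "a < L"
  obtains r where "lasso (max k (Suc a)) r" "r (max k (Suc a) - 1) = q a"
    "r ` {..<max k (Suc a)} \<subseteq> q ` {..<L}"
proof (cases "a < k")
  case True
  let ?r = "\<lambda>i. q ((a + 1 + i) mod k)"
  have "?r (k - 1) = q a" using True k3 by simp
  moreover have "?r ` {..<k} \<subseteq> q ` {..<L}"
  proof
    fix x assume "x \<in> ?r ` {..<k}"
    then obtain i where "x = q ((a + 1 + i) mod k)" by auto
    moreover have "(a + 1 + i) mod k < L"
      using k3 lassoD(1)[OF q] by (meson less_le_trans mod_less_divisor zero_less_numeral)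
    ultimately show "x \<in> q ` {..<L}" by blast
  qed
  moreover have "max k (Suc a) = k" using True by simp
  ultimately show ?thesis using that[of ?r] lasso_rotate[OF q True] by metis
next
  case False
  then have "lasso (Suc a) q" using q a by (auto simp: lasso_def inj_on_def)
  moreover have "max k (Suc a) = Suc a" "q ` {..<Suc a} \<subseteq> q ` {..<L}" using False a by auto
  ultimately show ?thesis using that[of q] by simp
qed

text \<open>Appending \<open>u\<close>, and then \<open>u'\<close>, to a lasso ending at
  \<open>q a\<close> gives competitors for the maximal length. The resulting bounds supply the
  distance of \<open>a\<close> from the end and the minimal lengths that the estimates above
  require.\<close>

lemma maximal_lasso_end:
  assumes q: "lasso L q" and max: "\<forall>L' q'. lasso L' q' \<longrightarrow> L' \<le> L"
    and u: "a < L" "(q a, u) \<in> parcs G" "u \<notin> q ` {..<L}"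
  shows "max k (Suc a) < L"
    and "(u, u') \<in> parcs G \<Longrightarrow> u' \<notin> q ` {..<L} \<Longrightarrow> max k (Suc a) + 1 < L"
proof -
  let ?M = "max k (Suc a)"
  obtain r where r: "lasso ?M r" "r (?M - 1) = q a" "r ` {..<?M} \<subseteq> q ` {..<L}"
    using lasso_ending_at[OF q u(1)] by blast
  have r1: "lasso (Suc ?M) (r(?M := u))" using r u by (intro lasso_snoc) auto
  then show "?M < L" using max by fastforce
  assume u': "(u, u') \<in> parcs G" "u' \<notin> q ` {..<L}"
  have "lasso (Suc (Suc ?M)) ((r(?M := u))(Suc ?M := u'))"
  proof (rule lasso_snoc[OF r1])
    show "u' \<notin> (r(?M := u)) ` {..<Suc ?M}"
    proof -
      have "u' \<notin> r ` {..<?M}" using u'(2) r(3) by blast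
      then show ?thesis using no_loops'[OF u'(1)] by (auto simp: less_Suc_eq)
    qed
  qed (use u' in simp)
  then show "?M + 1 < L" using max by fastforce
qed

end

context unicyclic_graph begin

lemma lasso_leaving_arc:
  assumes q: "lasso L q" and S: "q ` {..<L} \<subseteq> S" "S \<subseteq> pverts G" "S \<noteq> pverts G"
  obtains x u where "x \<in> S" "u \<in> pverts G" "u \<notin> S" "(x, u) \<in> parcs G"
proof -
  have "0 < L" using lassoD(1)[OF q] k3 by simp
  then have "q 0 \<in> S" using S(1) by auto
  then show ?thesis using connected_arc_leaving[OF conn S(2) _ S(3)] that by blast
qed

theorem triangle_lasso_minimises_square_radius:
  assumes H: "squared_lasso H n s" and n: "n = card (pverts G)" "n \<ge> 5"
    and no: "\<nexists>q. is_lasso G n 3 q"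
  shows "graph_spectral_radius H < square_radius"
proof -
  interpret H: squared_lasso H n s by fact
  have H4: "graph_spectral_radius H < square_radius" if "square_radius \<ge> 4"
    using H.radius_less_4[OF n(2)] that by linarith
  obtain L q where q: "lasso L q" and max: "\<forall>L' q'. lasso L' q' \<longrightarrow> L' \<le> L"
    using maximal_lasso by blast
  consider "k \<ge> 5" | "k = 3 \<or> k = 4" "L = n" | "k = 3 \<or> k = 4" "L < n"
    using k3 lasso_length_le[OF q] n by linarith
  then show ?thesis
  proof cases
    case 1
    then show ?thesis using H4 square_radius_ge_4_long_cycle by blast
  next
    \<comment> \<open>A spanning lasso with k = 3 would be a listing of the whole graph, contrary to
      \<open>no\<close>.\<close>
    case 2
    then show ?thesis
      using no lasso_spanning[OF q] spanning_4_lasso_greater[OF H n(2)] q n by blast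
  next
    case 3
    have sub: "q ` {..<L} \<subseteq> pverts G" by (rule lasso_verts[OF q])
    have cardq: "card (q ` {..<L}) = L" using card_image[OF lassoD(2)[OF q]] by simp
    have "q ` {..<L} \<noteq> pverts G" using cardq 3 n by auto
    then obtain x u where u: "x \<in> q ` {..<L}" "u \<in> pverts G" "u \<notin> q ` {..<L}" "(x, u) \<in> parcs G"
      using lasso_leaving_arc[OF q order_refl sub] by blast
    then obtain a where a: "a < L" "x = q a" by auto
    note end_u = maximal_lasso_end[OF q max a(1) u(4)[unfolded a(2)] u(3)]
    show ?thesis
    proof (cases "k = 4")
      case True
      then have "square_radius \<ge> 4"
        using square_radius_ge_4_attached_4[OF q _ True u(3) u(4)[unfolded a(2)]] end_u(1) by simp
      then show ?thesis by (rule H4)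
    next
      case False
      then have k: "k = 3" using 3 by simp
      have L4: "L \<ge> 4" using end_u(1) k by simp
      show ?thesis
      proof (cases "\<exists>u' b. u' \<noteq> u \<and> u' \<notin> q ` {..<L} \<and> b < L \<and> (q b, u') \<in> parcs G")
        case True
        then obtain u' b where u': "u' \<noteq> u" "u' \<notin> q ` {..<L}" "b < L" "(q b, u') \<in> parcs G" by blast
        have "Suc b < L" using maximal_lasso_end(1)[OF q max u'(3,4,2)] by simp
        then have "square_radius \<ge> 4"
          using square_radius_ge_4_two_attached[OF q L4 k u(3) u(4)[unfolded a(2)] _ u'(2,4)] u'(1) end_u(1)
          by simp
        then show ?thesis by (rule H4)
      next
        \<comment> \<open>Now \<open>u\<close> is the only outside vertex adjacent to the lasso, so
          any further vertex forces one that is reached through \<open>u\<close>.\<close>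
        case single: False
        show ?thesis
        proof (cases "insert u (q ` {..<L}) = pverts G")
          case True
          then have nL: "n = Suc L" using n cardq u(3) by (metis card_insert_disjoint finite_imageI finite_lessThan)
          show ?thesis
          proof (cases "a < 3")
            case True
            then show ?thesis
              using attached_near_triangle_greater[OF H n(2) q k nL u(3) u(4)[unfolded a(2)]] by blast
          next
            case False
            then show ?thesis
              using attached_far_greater[OF H q k nL u(3) u(4)[unfolded a(2)]] end_u(1) by simp
          qed
        next
          case False
          have "insert u (q ` {..<L}) \<subseteq> pverts G" using u(2) sub by simp
          from lasso_leaving_arc[OF q subset_insertI this False] obtain y u' where
            y: "y \<in> insert u (q ` {..<L})" "u' \<notin> insert u (q ` {..<L})" "(y, u') \<in> parcs G" .
          have "y = u" using single y by auto
          then have u': "(u, u') \<in> parcs G" "u' \<notin> q ` {..<L}" using y by auto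
          have "square_radius \<ge> 4"
            using square_radius_ge_4_attached_path[OF q _ k u(3) u(4)[unfolded a(2)] _ u'(2,1)]
              end_u(2)[OF u'] k by simp
          then show ?thesis by (rule H4)
        qed
      qed
    qed
  qed
qed

text \<open>A longest lasso spans: a vertex attached to a shorter one would give 3 <= k < L <
  4.\<close>

lemma order_4:
  assumes "card (pverts G) = 4"
  obtains q where "is_lasso G 4 3 q \<or> is_lasso G 4 4 q"
proof -
  obtain L q where q: "lasso L q" and max: "\<forall>L' q'. lasso L' q' \<longrightarrow> L' \<le> L"
    using maximal_lasso by blast
  have "L = 4"
  proof (rule ccontr)
    assume "L \<noteq> 4"
    then have L: "L < 4" using lasso_length_le[OF q] assms by simp
    then have "q ` {..<L} \<noteq> pverts G" using assms card_image[OF lassoD(2)[OF q]] by auto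
    from lasso_leaving_arc[OF q order_refl lasso_verts[OF q] this] obtain x u where
      u: "x \<in> q ` {..<L}" "u \<notin> q ` {..<L}" "(x, u) \<in> parcs G" .
    then obtain a where a: "a < L" "x = q a" by auto
    have "max k (Suc a) < L"
      by (rule maximal_lasso_end(1)[OF q max a(1) u(3)[unfolded a(2)] u(2)])
    then show False using L k3 by simp
  qed
  show ?thesis
  proof -
    have "k = 3 \<or> k = 4" using lassoD(1)[OF q] k3 \<open>L = 4\<close> by linarith
    then show ?thesis using lasso_spanning[OF q] assms \<open>L = 4\<close> that[of q] by auto
  qed
qed

end

section \<open>Comparison of the two candidates\<close>

lemma cycle_graph_square_radius_ge_4:
  assumes "n \<ge> 5"
  shows "graph_spectral_radius (graph_square (cycle_graph n)) \<ge> 4"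
proof -
  have l: "is_lasso (cycle_graph n) n n id" using assms by (intro is_lasso_cycle_graph) simp
  interpret pair_graph "cycle_graph n" using pair_graph_lasso[OF l] assms by simp
  interpret cyclic_graph "cycle_graph n" n id
    by unfold_locales (use assms in \<open>auto simp: cycle_graph_def\<close>)
  show ?thesis using square_radius_ge_4_long_cycle[OF assms] .
qed

theorem theorem4p4:
  fixes U :: "'a pair_pre_digraph" and n c v :: nat
    and W :: "(nat + nat) pair_pre_digraph" and m :: real
  assumes "unicyclic U" and "card (pverts U) = n" and "n \<ge> 4"
    and "c \<in> pverts (cycle_graph 3)" and "pendant_vertex (path_graph (n - 2)) v"
    and "W = coalescence (cycle_graph 3) c (path_graph (n - 2)) v"
    and "m = min (graph_spectral_radius (graph_square W))
                 (graph_spectral_radius (graph_square (cycle_graph n)))"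
  shows "graph_spectral_radius (graph_square U) \<ge> m \<and>
    (graph_spectral_radius (graph_square U) = m \<longleftrightarrow>
      digraph_iso (with_proj U) (with_proj W) \<and>
        graph_spectral_radius (graph_square W) = m \<or>
      digraph_iso (with_proj U) (with_proj (cycle_graph n)) \<and>
        graph_spectral_radius (graph_square (cycle_graph n)) = m)"
proof -
  obtain k d where "unicyclic_graph U k d" using unicyclicE[OF assms(1)] by blast
  then interpret U: unicyclic_graph U k d .
  obtain w where w: "is_lasso W n 3 w"
    using is_lasso_coalescence[OF assms(3-5)] unfolding assms(6) by blast
  note HW = squared_lasso_graph_square[OF w assms(3)]
  show ?thesis
  proof (cases "n = 4")
    case True
    \<comment> \<open>At order 4 all squares involved are complete, so every unicyclic graph attains
      \<open>m\<close> and is isomorphic to one of the candidates.\<close>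
    have C: "is_lasso (cycle_graph n) 4 4 id" using is_lasso_cycle_graph[of 4] True by simp
    obtain q where q: "is_lasso U 4 3 q \<or> is_lasso U 4 4 q"
      using U.order_4 assms(2) True by blast
    then have HU: "squared_lasso (graph_square U) 4 q"
      using squared_lasso_graph_square[of U 4 q] squared_lasso_square_4_cycle by auto
    have "digraph_iso (with_proj U) (with_proj W) \<or> digraph_iso (with_proj U) (with_proj (cycle_graph n))"
      using q digraph_iso_lassos[of U 4 3 q W w] digraph_iso_lassos[of U 4 4 q _ id] w C True by auto
    moreover have "graph_spectral_radius (graph_square U) = graph_spectral_radius (graph_square W)"
      using squared_lasso_radius_eq[OF HU] HW True by blast
    moreover have "graph_spectral_radius (graph_square U) = graph_spectral_radius (graph_square (cycle_graph n))"
      using squared_lasso_radius_eq[OF HU squared_lasso_square_4_cycle[OF C]] .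
    ultimately show ?thesis using assms(7) by auto
  next
    case False
    then have n5: "n \<ge> 5" using assms(3) by simp
    \<comment> \<open>The radius is below 4 for the square of \<open>W\<close> and at least 4 for
      that of the cycle, so the second alternative of the equality clause is void.\<close>
    have m: "m = graph_spectral_radius (graph_square W)"
      and C: "graph_spectral_radius (graph_square (cycle_graph n)) \<noteq> m"
      using squared_lasso.radius_less_4[OF HW n5] cycle_graph_square_radius_ge_4[OF n5] assms(7) by auto
    show ?thesis
    proof (cases "\<exists>q. is_lasso U n 3 q")
      case True
      then obtain q where q: "is_lasso U n 3 q" by blast
      have "graph_spectral_radius (graph_square U) = m"
        unfolding m by (rule squared_lasso_radius_eq[OF squared_lasso_graph_square[OF q assms(3)] HW])
      moreover have "digraph_iso (with_proj U) (with_proj W)"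
        by (rule digraph_iso_lassos[OF q w]) simp
      ultimately show ?thesis using m by simp
    next
      case False
      have "m < graph_spectral_radius (graph_square U)"
        unfolding m
        by (rule U.triangle_lasso_minimises_square_radius[OF HW assms(2)[symmetric] n5 False])
      moreover have "\<not> digraph_iso (with_proj U) (with_proj W)"
        using is_lasso_iso[OF _ w] False U.pair_wf_digraph by blast
      ultimately show ?thesis using C by auto
    qed
  qed
qed

end
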